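(* Let $\kappa\in(0,\frac12)$, let $\xi\in\mathcal W^{-1-\kappa,\infty}$, let $\Xi=(Y,Z)$ be an enhanced noise associated to $\xi$ satisfying the integrability assumption (I) of the context, and let $:\!H+\xi\!:$ be the associated self-adjoint operator. Let $\lambda\in\mathbb R$, $T>0$, $\gamma>0$ and let $u\in L^\infty_{loc}((-T,T),L^2(\mathbb R^2))\cap L^{2\gamma+1}_{loc}((-T,T),L^{4\gamma+2}(\mathbb R^2))$ be a solution of $$i\partial_tu+:\!H+\xi\!:u+\lambda|u|^{2\gamma}u=0 .$$ Then $|u(t)|_{L^2}=|u(0)|_{L^2}$ for all $t\in(-T,T)$.
   Context: Functions on $\mathbb R^2$ are complex-valued unless stated otherwise; $\langle x\rangle=(1+|x|^2)^{1/2}$; $L^2(\mathbb R^2)$ carries the real inner product $(f,g)_{L^2}=\mathrm{Re}\int f\bar g\,dx$. Hermite-Sobolev spaces: $H=\Delta-|x|^2$. For $s\in\mathbb R$, $p\in(1,\infty)$, $\mathcal W^{s,p}=\{u\in\mathcal S'(\mathbb R^2): (-H)^{s/2}u\in L^p\}$ with norm $|u|_{\mathcal W^{s,p}}=|(-H)^{s/2}u|_{L^p}$. For $p\in\{1,\infty\}$, $\mathcal W^{2,p}=\{u\in H^{2,p}(\mathbb R^2):\langle x\rangle^2u\in L^p\}$ with norm $|u|_{H^{2,p}}+|\langle x\rangle^2u|_{L^p}$ ($H^{2,p}$ the Sobolev space of functions with derivatives up to order 2 in $L^p$), $\mathcal W^{s,p}$ for $s\in[0,2]$ is defined by complex interpolation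 between $L^p$ and $\mathcal W^{2,p}$, and $\mathcal W^{s,\infty}=(\mathcal W^{-s,1})'$ for $s\in[-2,0)$. Noise: $\xi$ is real-valued. Let $\mathcal X^{-1-\kappa,\infty}$ be the closure of $\{(f,|\nabla f|^2-c): f,c\in\mathcal S(\mathbb R^2)\text{ real-valued}\}$ in $\mathcal W^{1-\kappa,\infty}\times\mathcal W^{-\kappa,\infty}$. An enhanced noise associated to $\xi$ is a pair $\Xi=(Y,Z)\in\mathcal X^{-1-\kappa,\infty}$ with $-HY=\xi$. Assumption (I): there exist $q_0>\frac2\kappa$ and $s_0\in(0,\kappa-\frac2{q_0})$ such that $\Xi\in\mathcal W^{1-s_0,q_0}\times\mathcal W^{-s_0,q_0}$. Put $\rho=e^Y$. Operator: $\mathcal D^{1,2}=\rho\mathcal W^{1,2}$ with norm $|\rho v|_{\mathcal D^{1,2}}^2=\int(|\nabla v|^2+|xv|^2)\rho^2dx$. For $u_i=\rho v_i\in\mathcal D^{1,2}$, $$a_\Xi(u_1,u_2)=\mathrm{Re}\int_{\mathbb R^2}\big(\nabla v_1\cdot\overline{\nabla v_2}+|x|^2(1-Y)v_1\overline{v_2}\big)\rho^2dx-\langle Z,\overline{v_1}v_2\rho^2\rangle,$$ the last bracket being the duality extension of $\mathrm{Re}\int Zv_1\overline{v_2}\rho^2dx$. There is $\delta_\Xi>0$ with $a_\Xi(u,u)+\delta_\Xi|u|_{L^2}^2\geqslant\frac12|u|_{\mathcal D^{1,2}}^2$ on $\mathcal D^{1,2}$; fix it. $-A$ is the positive self-adjoint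 operator on $L^2$ associated with the form $a_\Xi+\delta_\Xi(\cdot,\cdot)_{L^2}$: $u\in D(-A)$ iff $u\in\mathcal D^{1,2}$ and there is $f\in L^2$ with $a_\Xi(u,\phi)+\delta_\Xi(u,\phi)_{L^2}=(f,\phi)_{L^2}$ for all $\phi\in\mathcal D^{1,2}$, and then $-Au=f$. Finally $:\!H+\xi\!:\,=A+\delta_\Xi$, and $e^{it:H+\xi:}$ is the unitary group it generates. Solutions are mild, i.e. $u(t)=e^{it:H+\xi:}u(0)+i\lambda\int_0^te^{i(t-\tau):H+\xi:}[|u|^{2\gamma}u](\tau)d\tau$. *)

theory Defs
  imports "HOL-Analysis.Analysis" "HOL-Probability.Essential_Supremum"
begin

type_synonym plane = "real^2"
type_synonym distr = "(plane \<Rightarrow> complex) \<Rightarrow> complex"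

section \<open>Schwartz functions and tempered distributions\<close>

definition jap :: "plane \<Rightarrow> real" where
  "jap x = sqrt (1 + (norm x)\<^sup>2)"

definition pd :: "2 \<Rightarrow> (plane \<Rightarrow> complex) \<Rightarrow> plane \<Rightarrow> complex" where
  "pd i f x = frechet_derivative f (at x) (axis i 1)"

definition pds :: "2 list \<Rightarrow> (plane \<Rightarrow> complex) \<Rightarrow> plane \<Rightarrow> complex" where
  "pds is f = foldr pd is f"

definition schwartz :: "(plane \<Rightarrow> complex) set" where
  "schwartz = {f. \<forall>is. (\<forall>x. pds is f differentiable (at x)) \<and>
     (\<forall>n::nat. bounded (range (\<lambda>x. of_real (jap x ^ n) * pds is f x)))}"

definition schwartz_real :: "(plane \<Rightarrow> complex) set" where
  "schwartz_real = {f \<in> schwartz. \<forall>x. f x \<in> \<real>}"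

definition schwartz_seminorm :: "nat \<Rightarrow> (plane \<Rightarrow> complex) \<Rightarrow> real" where
  "schwartz_seminorm n f =
     (SUP (is, x) \<in> {is. length is \<le> n} \<times> UNIV. jap x ^ n * cmod (pds is f x))"

text \<open>A distribution is represented by a map on all functions which is required to vanish outside
  the Schwartz space, so that equality in HOL is equality of distributions.\<close>

definition tempered :: "distr set" where
  "tempered = {u.
     (\<forall>f. f \<notin> schwartz \<longrightarrow> u f = 0) \<and>
     (\<forall>f\<in>schwartz. \<forall>g\<in>schwartz. u (\<lambda>x. f x + g x) = u f + u g) \<and>
     (\<forall>c. \<forall>f\<in>schwartz. u (\<lambda>x. c * f x) = c * u f) \<and>
     (\<exists>C n. \<forall>f\<in>schwartz. cmod (u f) \<le> C * schwartz_seminorm n f)}"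

definition regular :: "(plane \<Rightarrow> complex) \<Rightarrow> bool" where
  "regular f \<longleftrightarrow> f \<in> borel_measurable lborel \<and>
     (\<forall>\<phi>\<in>schwartz. integrable lborel (\<lambda>x. f x * \<phi> x))"

definition reg_dist :: "(plane \<Rightarrow> complex) \<Rightarrow> distr" where
  "reg_dist f = (\<lambda>\<phi>. if \<phi> \<in> schwartz then (LINT x|lborel. f x * \<phi> x) else 0)"

definition dist_pd :: "2 \<Rightarrow> distr \<Rightarrow> distr" where
  "dist_pd i u = (\<lambda>\<phi>. if \<phi> \<in> schwartz then - u (pd i \<phi>) else 0)"

definition dist_mult :: "(plane \<Rightarrow> complex) \<Rightarrow> distr \<Rightarrow> distr" where
  "dist_mult m u = (\<lambda>\<phi>. if \<phi> \<in> schwartz then u (\<lambda>x. m x * \<phi> x) else 0)"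

definition dist_diff :: "distr \<Rightarrow> distr \<Rightarrow> distr" where
  "dist_diff u v = (\<lambda>\<phi>. u \<phi> - v \<phi>)"

definition dist_real :: "distr \<Rightarrow> bool" where
  "dist_real u \<longleftrightarrow> (\<forall>\<phi>\<in>schwartz_real. u \<phi> \<in> \<real>)"

text \<open>The Hermite operator \<open>H = \<Delta> - |x|\<^sup>2\<close> on functions, and on distributions by transposition.\<close>

definition herm :: "(plane \<Rightarrow> complex) \<Rightarrow> plane \<Rightarrow> complex" where
  "herm f x = (\<Sum>i\<in>UNIV. pd i (pd i f) x) - of_real ((norm x)\<^sup>2) * f x"

definition dist_herm :: "distr \<Rightarrow> distr" where
  "dist_herm u = (\<lambda>\<phi>. if \<phi> \<in> schwartz then u (herm \<phi>) else 0)"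

text \<open>\<open>v = (-H)\<^sup>a u\<close> by the spectral calculus.  The spectrum of \<open>-H\<close> is discrete and positive, its
  eigenfunctions are finite combinations of Hermite functions, hence Schwartz, and they span
  a dense subspace of the Schwartz space; so \<open>v\<close> is determined by its values on them.\<close>

definition herm_power :: "real \<Rightarrow> distr \<Rightarrow> distr \<Rightarrow> bool" where
  "herm_power a u v \<longleftrightarrow> u \<in> tempered \<and> v \<in> tempered \<and>
     (\<forall>\<phi>\<in>schwartz. \<forall>\<mu>>0. (\<forall>x. - herm \<phi> x = of_real \<mu> * \<phi> x) \<longrightarrow>
        v \<phi> = of_real (\<mu> powr a) * u \<phi>)"

section \<open>Norms with values in the extended nonnegative reals\<close>

text \<open>A normed space of functions or distributions is given by its norm, which is infinite exactly
  outside the space.\<close>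

definition enn_powr :: "ennreal \<Rightarrow> real \<Rightarrow> ennreal" where
  "enn_powr a r = (if a = \<infinity> then \<infinity> else ennreal (enn2real a powr r))"

definition Lp_norm :: "ennreal \<Rightarrow> (plane \<Rightarrow> complex) \<Rightarrow> ennreal" where
  "Lp_norm p f =
     (if f \<notin> borel_measurable lborel then \<infinity>
      else if p = \<infinity> then esssup lborel (\<lambda>x. ennreal (cmod (f x)))
      else enn_powr (\<integral>\<^sup>+x. ennreal (cmod (f x) powr enn2real p) \<partial>lborel) (1 / enn2real p))"

abbreviation L2 :: "(plane \<Rightarrow> complex) \<Rightarrow> bool" where
  "L2 f \<equiv> Lp_norm 2 f < \<infinity>"

definition L2_inner :: "(plane \<Rightarrow> complex) \<Rightarrow> (plane \<Rightarrow> complex) \<Rightarrow> real" where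
  "L2_inner f g = Re (LINT x|lborel. f x * cnj (g x))"

definition Lp_dnorm :: "ennreal \<Rightarrow> distr \<Rightarrow> ennreal" where
  "Lp_dnorm p u = (INF f\<in>{f. regular f \<and> reg_dist f = u}. Lp_norm p f)"

definition sobolev2_norm :: "ennreal \<Rightarrow> distr \<Rightarrow> ennreal" where
  "sobolev2_norm p u =
     (\<Sum>(a, b)\<in>{(a, b). a + b \<le> (2::nat)}. Lp_dnorm p ((dist_pd 1 ^^ a) ((dist_pd 2 ^^ b) u)))"

definition W2_norm :: "ennreal \<Rightarrow> distr \<Rightarrow> ennreal" where
  "W2_norm p u = sobolev2_norm p u + Lp_dnorm p (dist_mult (\<lambda>x. of_real ((jap x)\<^sup>2)) u)"

subsection \<open>Complex interpolation of a couple of spaces of complex-valued maps\<close>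

definition sum_norm ::
  "(('a \<Rightarrow> complex) \<Rightarrow> ennreal) \<Rightarrow> (('a \<Rightarrow> complex) \<Rightarrow> ennreal) \<Rightarrow> ('a \<Rightarrow> complex) \<Rightarrow> ennreal" where
  "sum_norm N0 N1 u = (INF (a, b)\<in>{(a, b). u = (\<lambda>\<phi>. a \<phi> + b \<phi>)}. N0 a + N1 b)"

text \<open>Admissible functions of the Calderon method: bounded and continuous on the closed strip with
  values in the sum space, holomorphic in the open strip, and continuous and vanishing at infinity
  with values in the respective endpoint space on each of the two boundary lines.\<close>

definition calderon ::
  "(('a \<Rightarrow> complex) \<Rightarrow> ennreal) \<Rightarrow> (('a \<Rightarrow> complex) \<Rightarrow> ennreal) \<Rightarrow> (complex \<Rightarrow> 'a \<Rightarrow> complex) set" where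
  "calderon N0 N1 = {F.
     (SUP z\<in>{z. 0 \<le> Re z \<and> Re z \<le> 1}. sum_norm N0 N1 (F z)) < \<infinity> \<and>
     (\<forall>z. 0 \<le> Re z \<and> Re z \<le> 1 \<longrightarrow>
        ((\<lambda>w. sum_norm N0 N1 (\<lambda>\<phi>. F w \<phi> - F z \<phi>)) \<longlongrightarrow> 0)
          (at z within {z. 0 \<le> Re z \<and> Re z \<le> 1})) \<and>
     (\<forall>z. 0 < Re z \<and> Re z < 1 \<longrightarrow>
        (\<exists>D. ((\<lambda>h. sum_norm N0 N1 (\<lambda>\<phi>. (F (z + h) \<phi> - F z \<phi>) / h - D \<phi>)) \<longlongrightarrow> 0) (at 0))) \<and>
     (\<forall>(j, N)\<in>{(0, N0), (1, N1)}.
        (\<forall>t. N (F (Complex j t)) < \<infinity>) \<and>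
        (\<forall>t. ((\<lambda>s. N (\<lambda>\<phi>. F (Complex j s) \<phi> - F (Complex j t) \<phi>)) \<longlongrightarrow> 0) (at t)) \<and>
        ((\<lambda>t. N (F (Complex j t))) \<longlongrightarrow> 0) at_infinity)}"

definition interp_norm ::
  "real \<Rightarrow> (('a \<Rightarrow> complex) \<Rightarrow> ennreal) \<Rightarrow> (('a \<Rightarrow> complex) \<Rightarrow> ennreal) \<Rightarrow> ('a \<Rightarrow> complex) \<Rightarrow> ennreal" where
  "interp_norm \<theta> N0 N1 u =
     (INF F\<in>{F \<in> calderon N0 N1. F (of_real \<theta>) = u}.
        max (SUP t. N0 (F (Complex 0 t))) (SUP t. N1 (F (Complex 1 t))))"

subsection \<open>Hermite-Sobolev spaces\<close>

definition W_mid_norm :: "real \<Rightarrow> ennreal \<Rightarrow> distr \<Rightarrow> ennreal" where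
  "W_mid_norm s p u = (INF v\<in>{v. herm_power (s / 2) u v}. Lp_dnorm p v)"

definition W_end_norm :: "real \<Rightarrow> ennreal \<Rightarrow> distr \<Rightarrow> ennreal" where
  "W_end_norm s p u =
     (if s = 0 then Lp_dnorm p u
      else if s = 2 then W2_norm p u
      else interp_norm (s / 2) (Lp_dnorm p) (W2_norm p) u)"

text \<open>The dual norm of \<open>\<W>\<^sup>-\<^sup>s\<^sup>,\<^sup>1\<close>. Since the Schwartz functions are continuously and densely
  embedded in that space, its bounded functionals are identified with the tempered distributions
  which are bounded on Schwartz functions for its norm.\<close>

definition W_dual_norm :: "real \<Rightarrow> distr \<Rightarrow> ennreal" where
  "W_dual_norm s u =
     (if u \<in> tempered
      then (SUP \<phi>\<in>{\<phi>\<in>schwartz. W_end_norm (- s) 1 (reg_dist \<phi>) \<le> 1}. ennreal (cmod (u \<phi>)))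
      else \<infinity>)"

definition W_norm :: "real \<Rightarrow> ennreal \<Rightarrow> distr \<Rightarrow> ennreal" where
  "W_norm s p u =
     (if 1 < p \<and> p < \<infinity> then W_mid_norm s p u
      else if (p = 1 \<or> p = \<infinity>) \<and> 0 \<le> s \<and> s \<le> 2 then W_end_norm s p u
      else if p = \<infinity> \<and> - 2 \<le> s \<and> s < 0 then W_dual_norm s u
      else undefined)"

section \<open>Enhanced noise\<close>

definition X_space :: "real \<Rightarrow> (distr \<times> distr) set" where
  "X_space \<kappa> = {(y, z).
     W_norm (1 - \<kappa>) \<infinity> y < \<infinity> \<and> W_norm (- \<kappa>) \<infinity> z < \<infinity> \<and>
     (\<forall>\<epsilon>>0. \<exists>f\<in>schwartz_real. \<exists>c\<in>schwartz_real.
        W_norm (1 - \<kappa>) \<infinity> (dist_diff y (reg_dist f)) < \<epsilon> \<and>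
        W_norm (- \<kappa>) \<infinity>
          (dist_diff z (reg_dist (\<lambda>x. of_real (\<Sum>i\<in>UNIV. (cmod (pd i f x))\<^sup>2) - c x))) < \<epsilon>)}"

definition fun_dist :: "(plane \<Rightarrow> real) \<Rightarrow> distr" where
  "fun_dist Y = reg_dist (\<lambda>x. of_real (Y x))"

text \<open>The first component of an enhanced noise is a bounded real function; it is given by a
  representative \<open>Y\<close>, because \<open>exp Y\<close> is needed.\<close>

definition enhanced_noise :: "real \<Rightarrow> distr \<Rightarrow> (plane \<Rightarrow> real) \<Rightarrow> distr \<Rightarrow> bool" where
  "enhanced_noise \<kappa> \<xi> Y Z \<longleftrightarrow>
     regular (\<lambda>x. of_real (Y x)) \<and> (fun_dist Y, Z) \<in> X_space \<kappa> \<and>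
     (\<lambda>\<phi>. - dist_herm (fun_dist Y) \<phi>) = \<xi>"

definition noise_integrability :: "real \<Rightarrow> (plane \<Rightarrow> real) \<Rightarrow> distr \<Rightarrow> bool" where
  "noise_integrability \<kappa> Y Z \<longleftrightarrow>
     (\<exists>q0 s0. q0 > 2 / \<kappa> \<and> 0 < s0 \<and> s0 < \<kappa> - 2 / q0 \<and>
        W_norm (1 - s0) (ennreal q0) (fun_dist Y) < \<infinity> \<and>
        W_norm (- s0) (ennreal q0) Z < \<infinity>)"

section \<open>The operator\<close>

definition rho :: "(plane \<Rightarrow> real) \<Rightarrow> plane \<Rightarrow> real" where
  "rho Y x = exp (Y x)"

definition unrho :: "(plane \<Rightarrow> real) \<Rightarrow> (plane \<Rightarrow> complex) \<Rightarrow> plane \<Rightarrow> complex" where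
  "unrho Y u x = u x / of_real (rho Y x)"

definition D12 :: "(plane \<Rightarrow> real) \<Rightarrow> (plane \<Rightarrow> complex) set" where
  "D12 Y = {u. regular (unrho Y u) \<and> W_norm 1 2 (reg_dist (unrho Y u)) < \<infinity>}"

text \<open>A representative of the distributional derivative, unique almost everywhere if it exists.\<close>

definition weak_pd :: "2 \<Rightarrow> (plane \<Rightarrow> complex) \<Rightarrow> plane \<Rightarrow> complex" where
  "weak_pd i v = (SOME g. regular g \<and> reg_dist g = dist_pd i (reg_dist v))"

definition D12_norm_sq :: "(plane \<Rightarrow> real) \<Rightarrow> (plane \<Rightarrow> complex) \<Rightarrow> real" where
  "D12_norm_sq Y u =
     (let v = unrho Y u in
      LINT x|lborel. ((\<Sum>i\<in>UNIV. (cmod (weak_pd i v x))\<^sup>2) + (norm x * cmod (v x))\<^sup>2) * (rho Y x)\<^sup>2)"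

text \<open>The bilinear pairing of \<open>Z \<in> \<W>\<^sup>-\<^sup>\<kappa>\<^sup>,\<^sup>\<infinity>\<close> with \<open>w \<in> \<W>\<^sup>\<kappa>\<^sup>,\<^sup>1\<close>, i.e. the continuous extension of
  \<open>Z\<close> from Schwartz functions to \<open>\<W>\<^sup>\<kappa>\<^sup>,\<^sup>1\<close>.\<close>

definition dual_ext :: "real \<Rightarrow> distr \<Rightarrow> (plane \<Rightarrow> complex) \<Rightarrow> complex" where
  "dual_ext \<kappa> Z w =
     (THE l. \<forall>\<phi>. range \<phi> \<subseteq> schwartz \<and>
        (\<lambda>n::nat. W_norm \<kappa> 1 (dist_diff (reg_dist (\<phi> n)) (reg_dist w))) \<longlonglongrightarrow> 0 \<longrightarrow>
        (\<lambda>n. Z (\<phi> n)) \<longlonglongrightarrow> l)"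

definition a_form ::
  "real \<Rightarrow> (plane \<Rightarrow> real) \<Rightarrow> distr \<Rightarrow> (plane \<Rightarrow> complex) \<Rightarrow> (plane \<Rightarrow> complex) \<Rightarrow> real" where
  "a_form \<kappa> Y Z u1 u2 =
     (let v1 = unrho Y u1; v2 = unrho Y u2 in
      Re (LINT x|lborel.
            ((\<Sum>i\<in>UNIV. weak_pd i v1 x * cnj (weak_pd i v2 x))
             + of_real ((norm x)\<^sup>2 * (1 - Y x)) * v1 x * cnj (v2 x)) * of_real ((rho Y x)\<^sup>2))
      - Re (dual_ext \<kappa> Z (\<lambda>x. v1 x * cnj (v2 x) * of_real ((rho Y x)\<^sup>2))))"

definition coercive ::
  "real \<Rightarrow> (plane \<Rightarrow> real) \<Rightarrow> distr \<Rightarrow> real \<Rightarrow> bool" where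
  "coercive \<kappa> Y Z \<delta> \<longleftrightarrow>
     (\<forall>u\<in>D12 Y. a_form \<kappa> Y Z u u + \<delta> * (enn2real (Lp_norm 2 u))\<^sup>2 \<ge> D12_norm_sq Y u / 2)"

text \<open>Graphs of \<open>-A\<close> and of \<open>:H+\<xi>: = A + \<delta>\<close>.\<close>

definition minus_A ::
  "real \<Rightarrow> (plane \<Rightarrow> real) \<Rightarrow> distr \<Rightarrow> real \<Rightarrow> (plane \<Rightarrow> complex) \<Rightarrow> (plane \<Rightarrow> complex) \<Rightarrow> bool" where
  "minus_A \<kappa> Y Z \<delta> u f \<longleftrightarrow> u \<in> D12 Y \<and> L2 f \<and>
     (\<forall>\<phi>\<in>D12 Y. a_form \<kappa> Y Z u \<phi> + \<delta> * L2_inner u \<phi> = L2_inner f \<phi>)"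

definition noisy_op ::
  "real \<Rightarrow> (plane \<Rightarrow> real) \<Rightarrow> distr \<Rightarrow> real \<Rightarrow> (plane \<Rightarrow> complex) \<Rightarrow> (plane \<Rightarrow> complex) \<Rightarrow> bool" where
  "noisy_op \<kappa> Y Z \<delta> u g \<longleftrightarrow> minus_A \<kappa> Y Z \<delta> u (\<lambda>x. of_real \<delta> * u x - g x)"

section \<open>Unitary groups and mild solutions\<close>

text \<open>Strongly continuous one-parameter groups of unitary operators of \<open>L\<^sup>2\<close>, acting on
  representatives modulo equality almost everywhere.\<close>

definition unitary_group :: "(real \<Rightarrow> (plane \<Rightarrow> complex) \<Rightarrow> plane \<Rightarrow> complex) \<Rightarrow> bool" where
  "unitary_group U \<longleftrightarrow>
     (\<forall>t f. L2 f \<longrightarrow> L2 (U t f) \<and> Lp_norm 2 (U t f) = Lp_norm 2 f) \<and>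
     (\<forall>t f g c. L2 f \<and> L2 g \<longrightarrow>
        (AE x in lborel. U t (\<lambda>y. f y + c * g y) x = U t f x + c * U t g x)) \<and>
     (\<forall>f. L2 f \<longrightarrow> (AE x in lborel. U 0 f x = f x)) \<and>
     (\<forall>s t f. L2 f \<longrightarrow> (AE x in lborel. U (s + t) f x = U s (U t f) x)) \<and>
     (\<forall>f. L2 f \<longrightarrow> ((\<lambda>t. Lp_norm 2 (\<lambda>x. U t f x - f x)) \<longlongrightarrow> 0) (at 0))"

text \<open>\<open>U t = exp (i t B)\<close> for the operator with graph \<open>B\<close>: the infinitesimal generator of \<open>U\<close>,
  with its natural domain, is \<open>i B\<close>.\<close>

definition unitary_group_of ::
  "((plane \<Rightarrow> complex) \<Rightarrow> (plane \<Rightarrow> complex) \<Rightarrow> bool) \<Rightarrow>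
   (real \<Rightarrow> (plane \<Rightarrow> complex) \<Rightarrow> plane \<Rightarrow> complex) \<Rightarrow> bool" where
  "unitary_group_of B U \<longleftrightarrow> unitary_group U \<and>
     (\<forall>u g. L2 u \<and> L2 g \<longrightarrow>
        (B u g \<longleftrightarrow>
         ((\<lambda>h. Lp_norm 2 (\<lambda>x. (U h u x - u x) / of_real h - \<i> * g x)) \<longlongrightarrow> 0) (at 0)))"

text \<open>Strong measurability and the Bochner integral for maps into the space with norm \<open>N\<close>, in
  parallel to the library notions, which require the target to be a type.\<close>

definition simple_in ::
  "((plane \<Rightarrow> complex) \<Rightarrow> ennreal) \<Rightarrow> real measure \<Rightarrow> (real \<Rightarrow> plane \<Rightarrow> complex) \<Rightarrow> bool" where
  "simple_in N M s \<longleftrightarrow> simple_function M s \<and> (\<forall>t\<in>space M. N (s t) < \<infinity>)"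

definition simple_integral :: "real measure \<Rightarrow> (real \<Rightarrow> plane \<Rightarrow> complex) \<Rightarrow> plane \<Rightarrow> complex" where
  "simple_integral M s = (\<lambda>x. \<Sum>y\<in>s ` space M. of_real (measure M {t\<in>space M. s t = y}) * y x)"

definition strongly_measurable ::
  "((plane \<Rightarrow> complex) \<Rightarrow> ennreal) \<Rightarrow> real measure \<Rightarrow> (real \<Rightarrow> plane \<Rightarrow> complex) \<Rightarrow> bool" where
  "strongly_measurable N M f \<longleftrightarrow>
     (\<exists>s. (\<forall>n::nat. simple_in N M (s n)) \<and>
        (AE t in M. (\<lambda>n. N (\<lambda>x. f t x - s n t x)) \<longlonglongrightarrow> 0))"

definition has_bochner ::
  "((plane \<Rightarrow> complex) \<Rightarrow> ennreal) \<Rightarrow> real measure \<Rightarrow> (real \<Rightarrow> plane \<Rightarrow> complex) \<Rightarrow> (plane \<Rightarrow> complex) \<Rightarrow> bool"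
where
  "has_bochner N M f I \<longleftrightarrow> N I < \<infinity> \<and> strongly_measurable N M f \<and>
     (\<exists>s. (\<forall>n::nat. simple_in N M (s n) \<and> emeasure M {t\<in>space M. s n t \<noteq> (\<lambda>x. 0)} < \<infinity>) \<and>
        (\<lambda>n. \<integral>\<^sup>+t. N (\<lambda>x. f t x - s n t x) \<partial>M) \<longlonglongrightarrow> 0 \<and>
        (\<lambda>n. N (\<lambda>x. simple_integral M (s n) x - I x)) \<longlonglongrightarrow> 0)"

text \<open>The oriented integral from \<open>a\<close> to \<open>b\<close>.\<close>

definition has_L2_integral ::
  "real \<Rightarrow> real \<Rightarrow> (real \<Rightarrow> plane \<Rightarrow> complex) \<Rightarrow> (plane \<Rightarrow> complex) \<Rightarrow> bool" where
  "has_L2_integral a b f I \<longleftrightarrow>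
     (if a \<le> b then has_bochner (Lp_norm 2) (restrict_space lborel {a..b}) f I
      else has_bochner (Lp_norm 2) (restrict_space lborel {b..a}) f (\<lambda>x. - I x))"

definition Linf_loc :: "real \<Rightarrow> ennreal \<Rightarrow> (real \<Rightarrow> plane \<Rightarrow> complex) \<Rightarrow> bool" where
  "Linf_loc T p u \<longleftrightarrow>
     strongly_measurable (Lp_norm p) (restrict_space lborel {-T<..<T}) u \<and>
     (\<forall>a b. - T < a \<and> a < b \<and> b < T \<longrightarrow>
        (\<exists>C<\<infinity>. AE t in restrict_space lborel {a..b}. Lp_norm p (u t) \<le> C))"

definition Lr_loc :: "real \<Rightarrow> real \<Rightarrow> ennreal \<Rightarrow> (real \<Rightarrow> plane \<Rightarrow> complex) \<Rightarrow> bool" where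
  "Lr_loc T r p u \<longleftrightarrow>
     strongly_measurable (Lp_norm p) (restrict_space lborel {-T<..<T}) u \<and>
     (\<forall>a b. - T < a \<and> a < b \<and> b < T \<longrightarrow>
        (\<integral>\<^sup>+t. enn_powr (Lp_norm p (u t)) r \<partial>restrict_space lborel {a..b}) < \<infinity>)"

definition nonlin :: "real \<Rightarrow> (plane \<Rightarrow> complex) \<Rightarrow> plane \<Rightarrow> complex" where
  "nonlin \<gamma> f x = of_real (cmod (f x) powr (2 * \<gamma>)) * f x"

definition mild_solution ::
  "(real \<Rightarrow> (plane \<Rightarrow> complex) \<Rightarrow> plane \<Rightarrow> complex) \<Rightarrow> real \<Rightarrow> real \<Rightarrow> real \<Rightarrow>
   (real \<Rightarrow> plane \<Rightarrow> complex) \<Rightarrow> bool" where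
  "mild_solution U lam \<gamma> T u \<longleftrightarrow>
     (\<forall>t\<in>{-T<..<T}. L2 (u t) \<and>
        (\<exists>I. has_L2_integral 0 t (\<lambda>\<tau>. U (t - \<tau>) (nonlin \<gamma> (u \<tau>))) I \<and>
           (AE x in lborel. u t x = U t (u 0) x + \<i> * of_real lam * I x)))"

end

theory Submission
  imports Defs
begin

text \<open>Pull the solution back along the free evolution: \<open>w(t) = U(-t) u(t)\<close>. Duhamel's formula says
  that \<open>w\<close> is a primitive of \<open>k(t) = i \<lambda> U(-t) (|u|\<^sup>2\<^sup>\<gamma> u)(t)\<close>, and \<open>k(t)\<close> is orthogonal to \<open>w(t)\<close> for
  the real inner product, because \<open>U(-t)\<close> is unitary and \<open>i \<lambda> |u|\<^sup>2\<^sup>\<gamma> u\<close> is an imaginary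
  multiple of \<open>u\<close> at each point. As \<open>U\<close> preserves norms, it remains to see that \<open>|w(t)|\<close> is constant. Only
  the group property and the unitarity of \<open>U\<close> enter; \<open>u\<close> need not take values in the domain of the
  generator.

  Duhamel's formula is used in its weak form, tested against a fixed \<open>h\<close> in \<open>L\<^sup>2\<close>, so that all time
  integrals are integrals of real functions (\<open>has_bochner_interval\<close>, \<open>duhamel_weak\<close>).

  The constancy of the norm (\<open>weak_derivative_orthogonal_imp_const_nrm\<close>) needs no differentiation
  almost everywhere. Let \<open>m\<close> be a primitive of \<open>|k|\<close>. Then \<open>|w(t) - w(s)| \<le> m(t) - m(s)\<close>, and in
  \<open>|w(t)|\<^sup>2 - |w(s)|\<^sup>2 = \<integral>\<^sub>s\<^sup>t (k(\<tau>), w(t) + w(s)) d\<tau>\<close> orthogonality allows \<open>2 w(\<tau>)\<close> to be subtracted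
  from \<open>w(t) + w(s)\<close>. So the left-hand side is bounded by \<open>(m(t) - m(s))\<^sup>2\<close>. Cutting the interval
  into \<open>n\<close> pieces on which \<open>m\<close> increases equally shows that \<open>|w|\<^sup>2\<close> changes by \<open>O(1/n)\<close> over
  the interval, for every \<open>n\<close>
  (\<open>quadratic_modulus_imp_const\<close>).\<close>

section \<open>Square-integrable functions\<close>

text \<open>Keeps \<open>\<infinity>\<close> from being rewritten to \<open>top\<close>, so that facts \<open>L2 f\<close> have one form throughout.\<close>

declare infinity_ennreal_def [simp del]

text \<open>The norm of \<open>L\<^sup>2\<close> as a real number; it has the value zero outside \<open>L\<^sup>2\<close>.\<close>

definition L2_nrm :: "(plane \<Rightarrow> complex) \<Rightarrow> real" where
  "L2_nrm f = enn2real (Lp_norm 2 f)"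

lemma Lp_norm_finite_iff:
  assumes "0 < r"
  shows "Lp_norm (ennreal r) f < \<infinity> \<longleftrightarrow>
    f \<in> borel_measurable lborel \<and> integrable lborel (\<lambda>x. cmod (f x) powr r)"
proof (cases "f \<in> borel_measurable lborel")
  case True
  have "Lp_norm (ennreal r) f < \<infinity> \<longleftrightarrow> (\<integral>\<^sup>+x. ennreal (cmod (f x) powr r) \<partial>lborel) < \<infinity>"
    using True assms by (auto simp: Lp_norm_def enn_powr_def infinity_ennreal_def less_top[symmetric])
  also have "\<dots> \<longleftrightarrow> integrable lborel (\<lambda>x. cmod (f x) powr r)"
    using True by (subst integrable_iff_bounded) (auto simp: infinity_ennreal_def)
  finally show ?thesis using True by simp
qed (auto simp: Lp_norm_def)

lemma L2_iff: "L2 f \<longleftrightarrow> f \<in> borel_measurable lborel \<and> integrable lborel (\<lambda>x. (cmod (f x))\<^sup>2)"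
proof -
  have "L2 f \<longleftrightarrow> f \<in> borel_measurable lborel \<and> integrable lborel (\<lambda>x. cmod (f x) powr 2)"
    using Lp_norm_finite_iff[of 2 f] by simp
  then show ?thesis by simp
qed

lemma L2_inner_self: "L2_inner f f = (LINT x|lborel. (cmod (f x))\<^sup>2)"
proof -
  have "(LINT x|lborel. f x * cnj (f x)) = (LINT x|lborel. complex_of_real ((cmod (f x))\<^sup>2))"
    by (simp only: complex_norm_square)
  then show ?thesis by (simp only: L2_inner_def integral_complex_of_real Re_complex_of_real)
qed

lemma L2_nrm_eq:
  assumes "L2 f" shows "L2_nrm f = sqrt (L2_inner f f)"
proof -
  have m: "f \<in> borel_measurable lborel" and i: "integrable lborel (\<lambda>x. (cmod (f x))\<^sup>2)"
    using assms by (auto simp: L2_iff)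
  have "(\<integral>\<^sup>+x. ennreal ((cmod (f x))\<^sup>2) \<partial>lborel) = ennreal (LINT x|lborel. (cmod (f x))\<^sup>2)"
    using i by (intro nn_integral_eq_integral) auto
  then have "L2_nrm f = (LINT x|lborel. (cmod (f x))\<^sup>2) powr (1/2)"
    using m by (simp add: L2_nrm_def Lp_norm_def enn_powr_def infinity_ennreal_def)
  also have "\<dots> = sqrt (LINT x|lborel. (cmod (f x))\<^sup>2)"
    by (simp add: powr_half_sqrt)
  also have "(LINT x|lborel. (cmod (f x))\<^sup>2) = L2_inner f f"
    by (rule L2_inner_self[symmetric])
  finally show ?thesis .
qed

lemma Lp_norm_L2_nrm: "L2 f \<Longrightarrow> Lp_norm 2 f = ennreal (L2_nrm f)"
  by (simp add: L2_nrm_def infinity_ennreal_def)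

lemma L2_nrm_nonneg [simp]: "0 \<le> L2_nrm f"
  by (simp add: L2_nrm_def)

lemma L2_zero: "L2 (\<lambda>x. 0)"
  by (simp add: L2_iff)

lemma L2_cmult: "L2 f \<Longrightarrow> L2 (\<lambda>x. c * f x)"
  by (auto simp: L2_iff norm_mult power_mult_distrib)

lemma L2_add:
  assumes "L2 f" "L2 g" shows "L2 (\<lambda>x. f x + g x)"
proof -
  have "integrable lborel (\<lambda>x. (cmod (f x + g x))\<^sup>2)"
  proof (rule Bochner_Integration.integrable_bound)
    show "integrable lborel (\<lambda>x. 2 * (cmod (f x))\<^sup>2 + 2 * (cmod (g x))\<^sup>2)"
      using assms by (auto simp: L2_iff)
    have "(cmod (f x + g x))\<^sup>2 \<le> 2 * (cmod (f x))\<^sup>2 + 2 * (cmod (g x))\<^sup>2" for x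
    proof -
      have "(cmod (f x + g x))\<^sup>2 \<le> (cmod (f x) + cmod (g x))\<^sup>2"
        by (intro power_mono norm_triangle_ineq) auto
      also have "\<dots> \<le> 2 * (cmod (f x))\<^sup>2 + 2 * (cmod (g x))\<^sup>2"
        using sum_squares_bound[of "cmod (f x)" "cmod (g x)"] by (simp add: power2_sum)
      finally show ?thesis .
    qed
    then show "AE x in lborel. norm ((cmod (f x + g x))\<^sup>2) \<le>
        norm (2 * (cmod (f x))\<^sup>2 + 2 * (cmod (g x))\<^sup>2)"
      by simp
  qed (use assms in \<open>auto simp: L2_iff\<close>)
  then show ?thesis using assms by (auto simp: L2_iff)
qed

lemma L2_diff: "L2 f \<Longrightarrow> L2 g \<Longrightarrow> L2 (\<lambda>x. f x - g x)"
  using L2_add[OF _ L2_cmult[of g "-1"], of f] by simp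

lemma L2_sum:
  assumes "finite A" "\<And>y. y \<in> A \<Longrightarrow> L2 (f y)"
  shows "L2 (\<lambda>x. \<Sum>y\<in>A. f y x)"
  using assms by (induction A rule: finite_induct) (auto intro!: L2_add L2_zero)

lemma integrable_L2_prod:
  assumes "L2 f" "L2 g" shows "integrable lborel (\<lambda>x. f x * cnj (g x))"
proof (rule Bochner_Integration.integrable_bound)
  show "integrable lborel (\<lambda>x. (cmod (f x))\<^sup>2 + (cmod (g x))\<^sup>2)"
    using assms by (auto simp: L2_iff)
  have "cmod (f x) * cmod (g x) \<le> (cmod (f x))\<^sup>2 + (cmod (g x))\<^sup>2" for x
    using sum_squares_bound[of "cmod (f x)" "cmod (g x)"]
      mult_nonneg_nonneg[OF norm_ge_zero norm_ge_zero, of "f x" "g x"] by linarith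
  then show "AE x in lborel. norm (f x * cnj (g x)) \<le> norm ((cmod (f x))\<^sup>2 + (cmod (g x))\<^sup>2)"
    by (simp add: norm_mult)
  have "cnj \<in> borel_measurable borel"
    by (intro borel_measurable_continuous_onI continuous_intros)
  then have [measurable]: "(\<lambda>x. cnj (g x)) \<in> borel_measurable lborel"
    using assms(2) by (auto simp: L2_iff intro: measurable_compose)
  show "(\<lambda>x. f x * cnj (g x)) \<in> borel_measurable lborel"
    using assms(1) by (auto simp: L2_iff)
qed

lemma L2_inner_add_left:
  "L2 f \<Longrightarrow> L2 g \<Longrightarrow> L2 h \<Longrightarrow> L2_inner (\<lambda>x. f x + g x) h = L2_inner f h + L2_inner g h"
  using integrable_L2_prod[of f h] integrable_L2_prod[of g h]
  by (simp add: L2_inner_def distrib_right)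

lemma L2_inner_cmult_left: "L2_inner (\<lambda>x. c * f x) g = L2_inner f (\<lambda>x. cnj c * g x)"
  by (simp add: L2_inner_def mult_ac)

lemma L2_inner_scale_left: "L2_inner (\<lambda>x. of_real r * f x) g = r * L2_inner f g"
  by (simp add: L2_inner_def mult.assoc)

lemma L2_inner_commute: "L2_inner f g = L2_inner g f"
proof -
  have "(LINT x|lborel. g x * cnj (f x)) = (LINT x|lborel. cnj (f x * cnj (g x)))"
    by (simp add: mult.commute)
  also have "\<dots> = cnj (LINT x|lborel. f x * cnj (g x))"
    by (rule Bochner_Integration.integral_cnj)
  finally show ?thesis by (simp add: L2_inner_def)
qed

lemma L2_inner_scale_right: "L2_inner f (\<lambda>x. of_real r * g x) = r * L2_inner f g"
  using L2_inner_scale_left[of r g f] by (simp add: L2_inner_commute)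

lemma L2_inner_add_right:
  "L2 f \<Longrightarrow> L2 g \<Longrightarrow> L2 h \<Longrightarrow> L2_inner h (\<lambda>x. f x + g x) = L2_inner h f + L2_inner h g"
  using L2_inner_add_left[of f g h] by (simp add: L2_inner_commute)

lemma L2_inner_diff_left:
  "L2 f \<Longrightarrow> L2 g \<Longrightarrow> L2 h \<Longrightarrow> L2_inner (\<lambda>x. f x - g x) h = L2_inner f h - L2_inner g h"
  using L2_inner_add_left[of f "\<lambda>x. of_real (-1) * g x" h] L2_cmult[of g "of_real (-1)"]
    L2_inner_scale_left[of "-1" g h] by simp

lemma L2_inner_diff_right:
  "L2 f \<Longrightarrow> L2 g \<Longrightarrow> L2 h \<Longrightarrow> L2_inner h (\<lambda>x. f x - g x) = L2_inner h f - L2_inner h g"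
  using L2_inner_diff_left[of f g h] by (simp add: L2_inner_commute)

lemma L2_inner_sum_left:
  assumes "finite A" "\<And>y. y \<in> A \<Longrightarrow> L2 (f y)" "L2 h"
  shows "L2_inner (\<lambda>x. \<Sum>y\<in>A. f y x) h = (\<Sum>y\<in>A. L2_inner (f y) h)"
  using assms
proof (induction A rule: finite_induct)
  case empty then show ?case by (simp add: L2_inner_def)
next
  case (insert a A)
  then show ?case using L2_inner_add_left[of "f a" "\<lambda>x. \<Sum>y\<in>A. f y x" h] L2_sum[of A f] by simp
qed

lemma L2_inner_cong_AE:
  assumes "L2 f" "L2 f'" "L2 g" "L2 g'"
    and "AE x in lborel. f x = f' x" "AE x in lborel. g x = g' x"
  shows "L2_inner f g = L2_inner f' g'"
proof -
  have "(LINT x|lborel. f x * cnj (g x)) = (LINT x|lborel. f' x * cnj (g' x))"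
    using assms(5,6) integrable_L2_prod[OF assms(1,3)] integrable_L2_prod[OF assms(2,4)]
    by (intro integral_cong_AE) auto
  then show ?thesis by (simp add: L2_inner_def)
qed

lemma L2_inner_self_nonneg [simp]: "0 \<le> L2_inner f f"
  by (simp add: L2_inner_self)

lemma L2_nrm_sq: "L2 f \<Longrightarrow> (L2_nrm f)\<^sup>2 = L2_inner f f"
  by (simp add: L2_nrm_eq)

lemma L2_nrm_add_sq:
  assumes "L2 f" "L2 g"
  shows "(L2_nrm (\<lambda>x. f x + g x))\<^sup>2 = (L2_nrm f)\<^sup>2 + 2 * L2_inner f g + (L2_nrm g)\<^sup>2"
  using assms L2_add[OF assms]
  by (simp add: L2_nrm_sq L2_inner_add_left L2_inner_add_right L2_inner_commute[of g f])

lemma L2_Cauchy_Schwarz: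
  assumes "L2 f" "L2 g" shows "\<bar>L2_inner f g\<bar> \<le> L2_nrm f * L2_nrm g"
proof -
  have quad: "0 \<le> (L2_nrm f)\<^sup>2 + 2 * r * L2_inner f g + r\<^sup>2 * (L2_nrm g)\<^sup>2" for r
  proof -
    have g': "L2 (\<lambda>x. of_real r * g x)" using assms by (intro L2_cmult)
    have "(L2_nrm (\<lambda>x. of_real r * g x))\<^sup>2 = r\<^sup>2 * (L2_nrm g)\<^sup>2"
      using g' assms by (simp add: L2_nrm_sq L2_inner_scale_left L2_inner_scale_right)
        (simp add: power2_eq_square)
    then show ?thesis
      using L2_nrm_add_sq[OF assms(1) g'] zero_le_power2[of "L2_nrm (\<lambda>x. f x + of_real r * g x)"]
      by (simp add: L2_inner_scale_right)
  qed
  have "(L2_inner f g)\<^sup>2 \<le> (L2_nrm f)\<^sup>2 * (L2_nrm g)\<^sup>2"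
  proof (cases "L2_nrm g = 0")
    case True
    have "L2_inner f g = 0"
    proof (rule ccontr)
      assume ne: "L2_inner f g \<noteq> 0"
      have "0 \<le> (L2_nrm f)\<^sup>2 + 2 * (- ((L2_nrm f)\<^sup>2 + 1) / (2 * L2_inner f g)) * L2_inner f g"
        using quad[of "- ((L2_nrm f)\<^sup>2 + 1) / (2 * L2_inner f g)"] True by simp
      then show False using ne by (simp add: field_simps)
    qed
    then show ?thesis using True by simp
  next
    case False
    then have pos: "0 < (L2_nrm g)\<^sup>2" by simp
    let ?r = "- L2_inner f g / (L2_nrm g)\<^sup>2"
    have "(L2_nrm f)\<^sup>2 + 2 * ?r * L2_inner f g + ?r\<^sup>2 * (L2_nrm g)\<^sup>2
        = (L2_nrm f)\<^sup>2 - (L2_inner f g)\<^sup>2 / (L2_nrm g)\<^sup>2"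
      using pos by (simp add: field_simps power2_eq_square)
    then have "(L2_inner f g)\<^sup>2 / (L2_nrm g)\<^sup>2 \<le> (L2_nrm f)\<^sup>2" using quad[of ?r] by simp
    then show ?thesis using pos by (simp add: field_simps)
  qed
  then show ?thesis
    by (intro abs_le_square_iff[THEN iffD2, of "L2_inner f g" "L2_nrm f * L2_nrm g", simplified abs_mult abs_of_nonneg L2_nrm_nonneg])
       (simp add: power_mult_distrib)
qed

lemma L2_nrm_triangle:
  assumes "L2 f" "L2 g" shows "L2_nrm (\<lambda>x. f x + g x) \<le> L2_nrm f + L2_nrm g"
proof (rule power2_le_imp_le)
  have "L2_inner f g \<le> L2_nrm f * L2_nrm g" using L2_Cauchy_Schwarz[OF assms] by simp
  then show "(L2_nrm (\<lambda>x. f x + g x))\<^sup>2 \<le> (L2_nrm f + L2_nrm g)\<^sup>2"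
    by (simp add: L2_nrm_add_sq[OF assms] power2_sum)
qed simp

lemma L2_nrm_minus_commute:
  assumes "L2 f" "L2 g" shows "L2_nrm (\<lambda>x. f x - g x) = L2_nrm (\<lambda>x. g x - f x)"
proof -
  have "L2_inner (\<lambda>x. f x - g x) (\<lambda>x. f x - g x) = L2_inner (\<lambda>x. g x - f x) (\<lambda>x. g x - f x)"
    using L2_diff[OF assms] L2_diff[OF assms(2,1)] assms
    by (simp add: L2_inner_diff_left L2_inner_diff_right)
  then show ?thesis using assms by (simp add: L2_nrm_eq L2_diff)
qed

lemma L2_nrm_diff_abs:
  assumes "L2 f" "L2 g" shows "\<bar>L2_nrm f - L2_nrm g\<bar> \<le> L2_nrm (\<lambda>x. f x - g x)"
  using L2_nrm_triangle[OF L2_diff[OF assms] assms(2)]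
    L2_nrm_triangle[OF L2_diff[OF assms(2,1)] assms(1)] L2_nrm_minus_commute[OF assms]
  by simp

section \<open>Bochner integrals of square-integrable functions\<close>

text \<open>The function \<open>q\<close> need not be Borel measurable, but the pointwise limit of the measurable \<open>s n\<close>
  supplies a measurable version \<open>r\<close>. The dominating functions \<open>e n\<close> need not be measurable either:
  their integrals are only used as upper bounds.\<close>

lemma L1_limit:
  fixes q :: "'a \<Rightarrow> real" and p s :: "nat \<Rightarrow> 'a \<Rightarrow> real"
  assumes s: "\<And>n. s n \<in> borel_measurable M" "AE t in M. (\<lambda>n. s n t) \<longlonglongrightarrow> q t"
    and p: "\<And>n. integrable M (p n)"
    and e: "\<And>n. AE t in M. ennreal \<bar>p n t - q t\<bar> \<le> e n t" "(\<lambda>n. \<integral>\<^sup>+t. e n t \<partial>M) \<longlonglongrightarrow> 0"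
  obtains r where "integrable M r" "AE t in M. r t = q t" "(\<lambda>n. LINT t|M. p n t) \<longlonglongrightarrow> (LINT t|M. r t)"
proof -
  define r where "r t = lim (\<lambda>n. s n t)" for t
  have r_meas: "r \<in> borel_measurable M"
    unfolding r_def by (intro borel_measurable_lim_metric s)
  have r_eq: "AE t in M. r t = q t"
    using s(2) by eventually_elim (simp add: r_def limI)
  have le: "(\<integral>\<^sup>+t. norm (p n t - r t) \<partial>M) \<le> (\<integral>\<^sup>+t. e n t \<partial>M)" for n
  proof (rule nn_integral_mono_AE)
    show "AE t in M. ennreal (norm (p n t - r t)) \<le> e n t"
      using r_eq e(1)[of n] by eventually_elim simp
  qed
  have lim: "(\<lambda>n. \<integral>\<^sup>+t. norm (p n t - r t) \<partial>M) \<longlonglongrightarrow> 0"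
    by (rule tendsto_sandwich[OF _ _ tendsto_const e(2)]) (use le in auto)
  have "eventually (\<lambda>n. (\<integral>\<^sup>+t. norm (p n t - r t) \<partial>M) < 1) sequentially"
    by (rule order_tendstoD(2)[OF lim]) simp
  then obtain n where n: "(\<integral>\<^sup>+t. norm (p n t - r t) \<partial>M) < 1"
    by (auto simp: eventually_sequentially)
  have "integrable M (\<lambda>t. p n t - r t)"
  proof (rule integrableI_bounded)
    show "(\<lambda>t. p n t - r t) \<in> borel_measurable M"
      using r_meas borel_measurable_integrable[OF p[of n]] by simp
    show "(\<integral>\<^sup>+t. norm (p n t - r t) \<partial>M) < \<infinity>"
      using n by (rule less_trans) (simp add: infinity_ennreal_def)
  qed
  from Bochner_Integration.integrable_diff[OF p[of n] this] have "integrable M r" by simp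
  moreover have "(\<lambda>n. LINT t|M. p n t) \<longlonglongrightarrow> (LINT t|M. r t)"
    by (rule tendsto_L1_int[OF p \<open>integrable M r\<close> lim])
  ultimately show ?thesis using r_eq that by blast
qed

lemma simple_in_compose_integrable:
  fixes p :: "(plane \<Rightarrow> complex) \<Rightarrow> real"
  assumes "finite_measure M" "simple_in N M s"
  shows "integrable M (\<lambda>t. p (s t))"
proof -
  interpret finite_measure M by fact
  have sf: "simple_function M (\<lambda>t. p (s t))"
    using assms(2) simple_function_compose1[of M s p] by (simp add: simple_in_def)
  have "finite ((\<lambda>t. p (s t)) ` space M)" using sf by (rule simple_functionD)
  then obtain B where "\<And>y. y \<in> (\<lambda>t. p (s t)) ` space M \<Longrightarrow> norm y \<le> B"
    using finite_imp_bounded bounded_iff by metis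
  then show ?thesis
    by (intro integrable_const_bound[where B = B] AE_I2 borel_measurable_simple_function sf) auto
qed

lemma L2_simple_integral:
  assumes "simple_in (Lp_norm 2) M s" shows "L2 (simple_integral M s)"
  using assms unfolding simple_integral_def simple_in_def
  by (intro L2_sum L2_cmult) (auto dest: simple_functionD)

lemma L2_inner_simple_integral:
  assumes "finite_measure M" "simple_in (Lp_norm 2) M s" "L2 h"
  shows "L2_inner (simple_integral M s) h = (LINT t|M. L2_inner (s t) h)"
proof -
  interpret finite_measure M by fact
  let ?A = "\<lambda>y. {t\<in>space M. s t = y}"
  have fin: "finite (s ` space M)" and L2s: "\<And>y. y \<in> s ` space M \<Longrightarrow> L2 y"
    using assms(2) by (auto simp: simple_in_def dest: simple_functionD)
  have A: "?A y \<in> sets M" for y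
  proof -
    have "?A y = s -` {y} \<inter> space M" by auto
    then show ?thesis using assms(2) by (auto simp: simple_in_def dest: simple_functionD)
  qed
  have "(LINT t|M. L2_inner (s t) h) = (LINT t|M. (\<Sum>y\<in>s ` space M. indicator (?A y) t *\<^sub>R L2_inner y h))"
  proof (rule Bochner_Integration.integral_cong)
    fix t assume t: "t \<in> space M"
    have "(\<Sum>y\<in>s ` space M. indicator (?A y) t *\<^sub>R L2_inner y h)
        = (\<Sum>y\<in>s ` space M. if s t = y then L2_inner y h else 0)"
      using t by (intro sum.cong) auto
    then show "L2_inner (s t) h = (\<Sum>y\<in>s ` space M. indicator (?A y) t *\<^sub>R L2_inner y h)"
      using fin t by (simp add: sum.delta)
  qed simp
  also have "\<dots> = (\<Sum>y\<in>s ` space M. measure M (?A y) * L2_inner y h)"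
  proof -
    have "integrable M (\<lambda>t. indicator (?A y) t *\<^sub>R L2_inner y h)" for y
      using A[of y] emeasure_finite[of "?A y"]
      by (intro integrable_scaleR_left integrable_real_indicator) (simp_all add: less_top[symmetric] infinity_ennreal_def)
    moreover have "?A y \<inter> space M = ?A y" for y by auto
    ultimately show ?thesis by (simp add: Bochner_Integration.integral_sum)
  qed
  also have "\<dots> = L2_inner (simple_integral M s) h"
    unfolding simple_integral_def using fin L2s assms(3)
    by (subst L2_inner_sum_left) (auto simp: L2_inner_scale_left intro!: L2_cmult)
  finally show ?thesis ..
qed

lemma L2_diff_cancel: "L2 (\<lambda>x. f x - g x) \<Longrightarrow> L2 g \<Longrightarrow> L2 f"
  using L2_add[of "\<lambda>x. f x - g x" g] by simp

text \<open>Pairing with a fixed function of \<open>L\<^sup>2\<close> turns the Bochner integral into a scalar integral; the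
  norm of the integrand is integrable. The integrable versions \<open>r\<close> are needed because the scalar
  functions themselves are measurable only up to a null set.\<close>

lemma has_bochner_L2:
  assumes M: "finite_measure M" and f: "has_bochner (Lp_norm 2) M f I"
  shows has_bochner_AE_L2: "AE t in M. L2 (f t)"
    and has_bochner_inner: "L2 h \<Longrightarrow>
      \<exists>r. integrable M r \<and> (AE t in M. r t = L2_inner (f t) h) \<and> (LINT t|M. r t) = L2_inner I h"
    and has_bochner_nrm: "\<exists>r. integrable M r \<and> (AE t in M. r t = L2_nrm (f t))"
proof -
  obtain s where s: "\<And>n::nat. simple_in (Lp_norm 2) M (s n)"
    and s_lim: "AE t in M. (\<lambda>n. Lp_norm 2 (\<lambda>x. f t x - s n t x)) \<longlonglongrightarrow> 0"
    using f by (auto simp: has_bochner_def strongly_measurable_def)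
  obtain p where p: "\<And>n::nat. simple_in (Lp_norm 2) M (p n)"
    and p_lim: "(\<lambda>n. \<integral>\<^sup>+t. Lp_norm 2 (\<lambda>x. f t x - p n t x) \<partial>M) \<longlonglongrightarrow> 0"
    and I_lim: "(\<lambda>n. Lp_norm 2 (\<lambda>x. simple_integral M (p n) x - I x)) \<longlonglongrightarrow> 0"
    and I: "L2 I"
    using f by (auto simp: has_bochner_def)
  have L2s: "L2 (s n t)" "L2 (p n t)" if "t \<in> space M" for n t
    using s[of n] p[of n] that by (auto simp: simple_in_def)
  show L2f: "AE t in M. L2 (f t)"
    using s_lim AE_space
  proof eventually_elim
    case (elim t)
    from order_tendstoD(2)[OF elim(1), of \<infinity>] obtain n where "L2 (\<lambda>x. f t x - s n t x)"
      by (auto simp: eventually_sequentially infinity_ennreal_def)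
    then show ?case using L2s(1)[OF elim(2)] by (rule L2_diff_cancel)
  qed
  have nrm_lim: "AE t in M. (\<lambda>n. L2_nrm (\<lambda>x. f t x - s n t x)) \<longlonglongrightarrow> 0"
    using s_lim by eventually_elim (auto simp: L2_nrm_def intro!: tendsto_enn2real)
  show "\<exists>r. integrable M r \<and> (AE t in M. r t = L2_nrm (f t))"
  proof -
    obtain r where "integrable M r" "AE t in M. r t = L2_nrm (f t)"
    proof (rule L1_limit)
      show "(\<lambda>t. L2_nrm (s n t)) \<in> borel_measurable M" for n
        using simple_in_compose_integrable[OF M s] by (rule borel_measurable_integrable)
      show "AE t in M. (\<lambda>n. L2_nrm (s n t)) \<longlonglongrightarrow> L2_nrm (f t)"
        using nrm_lim L2f AE_space
      proof eventually_elim
        case (elim t)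
        show ?case
          by (rule Lim_null[THEN iffD2], rule Lim_null_comparison[OF _ elim(1)])
            (use L2_nrm_diff_abs[OF elim(2) L2s(1)[OF elim(3)]] in
              \<open>auto intro!: always_eventually simp: abs_minus_commute\<close>)
      qed
      show "integrable M (\<lambda>t. L2_nrm (p n t))" for n
        by (rule simple_in_compose_integrable[OF M p])
      show "AE t in M. ennreal \<bar>L2_nrm (p n t) - L2_nrm (f t)\<bar> \<le> Lp_norm 2 (\<lambda>x. f t x - p n t x)" for n
        using L2f AE_space
      proof eventually_elim
        case (elim t)
        show ?case
          using L2_nrm_diff_abs[OF elim(1) L2s(2)[OF elim(2), of n]]
          by (subst Lp_norm_L2_nrm[OF L2_diff[OF elim(1) L2s(2)[OF elim(2)]]])
            (simp add: abs_minus_commute ennreal_leI)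
      qed
    qed (rule p_lim)
    then show ?thesis by blast
  qed
  show "\<exists>r. integrable M r \<and> (AE t in M. r t = L2_inner (f t) h) \<and> (LINT t|M. r t) = L2_inner I h"
    if h: "L2 h"
  proof -
    \<comment> \<open>The shift by one keeps the normalization meaningful for \<open>h = 0\<close>.\<close>
    define c where "c = L2_nrm h + 1"
    have c: "0 < c" by (simp add: c_def add_nonneg_pos)
    have bound: "\<bar>L2_inner g h / c - L2_inner g' h / c\<bar> \<le> L2_nrm (\<lambda>x. g' x - g x)"
      if "L2 g" "L2 g'" for g g'
    proof -
      have "\<bar>L2_inner g h - L2_inner g' h\<bar> = \<bar>L2_inner (\<lambda>x. g' x - g x) h\<bar>"
        using that h by (simp add: L2_inner_diff_left)
      also have "\<dots> \<le> L2_nrm (\<lambda>x. g' x - g x) * L2_nrm h"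
        by (rule L2_Cauchy_Schwarz[OF L2_diff[OF that(2,1)] h])
      also have "\<dots> \<le> L2_nrm (\<lambda>x. g' x - g x) * c"
        by (intro mult_left_mono) (auto simp: c_def)
      finally show ?thesis using c by (simp add: diff_divide_distrib[symmetric] field_simps)
    qed
    obtain r where r: "integrable M r" "AE t in M. r t = L2_inner (f t) h / c"
      "(\<lambda>n. LINT t|M. L2_inner (p n t) h / c) \<longlonglongrightarrow> (LINT t|M. r t)"
    proof (rule L1_limit)
      show "(\<lambda>t. L2_inner (s n t) h / c) \<in> borel_measurable M" for n
        using simple_in_compose_integrable[OF M s] by (rule borel_measurable_integrable)
      show "AE t in M. (\<lambda>n. L2_inner (s n t) h / c) \<longlonglongrightarrow> L2_inner (f t) h / c"
        using nrm_lim L2f AE_space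
      proof eventually_elim
        case (elim t)
        show ?case
          by (rule Lim_null[THEN iffD2], rule Lim_null_comparison[OF _ elim(1)])
            (use bound[OF L2s(1)[OF elim(3)] elim(2)] in \<open>auto intro!: always_eventually\<close>)
      qed
      show "integrable M (\<lambda>t. L2_inner (p n t) h / c)" for n
        by (rule simple_in_compose_integrable[OF M p])
      show "AE t in M. ennreal \<bar>L2_inner (p n t) h / c - L2_inner (f t) h / c\<bar>
          \<le> Lp_norm 2 (\<lambda>x. f t x - p n t x)" for n
        using L2f AE_space
      proof eventually_elim
        case (elim t)
        show ?case
          using bound[OF L2s(2)[OF elim(2), of n] elim(1)]
          by (subst Lp_norm_L2_nrm[OF L2_diff[OF elim(1) L2s(2)[OF elim(2)]]]) (rule ennreal_leI)
      qed
    qed (rule p_lim)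
    have "(\<lambda>n. L2_inner (simple_integral M (p n)) h / c) \<longlonglongrightarrow> L2_inner I h / c"
    proof (rule Lim_null[THEN iffD2], rule Lim_null_comparison)
      show "(\<lambda>n. L2_nrm (\<lambda>x. simple_integral M (p n) x - I x)) \<longlonglongrightarrow> 0"
        using I_lim by (auto simp: L2_nrm_def intro!: tendsto_enn2real)
      have "norm (L2_inner (simple_integral M (p n)) h / c - L2_inner I h / c)
          \<le> L2_nrm (\<lambda>x. simple_integral M (p n) x - I x)" for n
        using bound[OF I L2_simple_integral[OF p]] by (simp add: abs_minus_commute)
      then show "\<forall>\<^sub>F n in sequentially. norm (L2_inner (simple_integral M (p n)) h / c - L2_inner I h / c)
          \<le> L2_nrm (\<lambda>x. simple_integral M (p n) x - I x)" by simp
    qed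
    then have "(LINT t|M. r t) = L2_inner I h / c"
      using r(3) L2_inner_simple_integral[OF M p h] by (simp add: LIMSEQ_unique)
    then have "(LINT t|M. c * r t) = L2_inner I h" using c by simp
    moreover have "AE t in M. c * r t = L2_inner (f t) h"
      using r(2) by eventually_elim (use c in simp)
    ultimately show ?thesis using r(1) by (intro exI[of _ "\<lambda>t. c * r t"]) simp
  qed
qed

lemma has_integral_restrict_lborel:
  fixes r q :: "real \<Rightarrow> real"
  assumes "integrable (restrict_space lborel {a..b}) r" "AE t in restrict_space lborel {a..b}. r t = q t"
  shows "(q has_integral (LINT t|restrict_space lborel {a..b}. r t)) {a..b}"
proof -
  have "((\<lambda>t. indicator {a..b} t *\<^sub>R r t) has_integral (LINT t|restrict_space lborel {a..b}. r t)) UNIV"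
    using assms(1) by (simp add: integrable_restrict_space integral_restrict_space has_integral_integral_lborel)
  then have "(r has_integral (LINT t|restrict_space lborel {a..b}. r t)) {a..b}"
    by (simp only: indicator_scaleR_eq_if has_integral_restrict_UNIV)
  then show ?thesis
    using assms(2) by (subst (asm) has_integral_AE[of _ _ q]) (auto simp: AE_restrict_space_iff)
qed

lemma finite_measure_restrict_Icc: "finite_measure (restrict_space lborel {a..b::real})"
  by (rule finite_measureI) (simp add: space_restrict_space emeasure_restrict_space emeasure_lborel_Icc_eq infinity_ennreal_def)

text \<open>Henstock--Kurzweil integrals do not see the null sets on which measurability may fail.\<close>

lemma has_bochner_interval:
  assumes "has_bochner (Lp_norm 2) (restrict_space lborel {a..b}) f I"
  shows "AE t in lborel. t \<in> {a..b} \<longrightarrow> L2 (f t)"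
    and "(\<lambda>t. L2_nrm (f t)) integrable_on {a..b}"
    and "L2 h \<Longrightarrow> ((\<lambda>t. L2_inner (f t) h) has_integral L2_inner I h) {a..b}"
proof -
  note M = finite_measure_restrict_Icc[of a b]
  show "AE t in lborel. t \<in> {a..b} \<longrightarrow> L2 (f t)"
    using has_bochner_AE_L2[OF M assms] by (simp add: AE_restrict_space_iff)
  show "(\<lambda>t. L2_nrm (f t)) integrable_on {a..b}"
  proof -
    from has_bochner_nrm[OF M assms] obtain r
      where r: "integrable (restrict_space lborel {a..b}) r"
        "AE t in restrict_space lborel {a..b}. r t = L2_nrm (f t)" by blast
    show ?thesis using has_integral_restrict_lborel[OF r] by (rule has_integral_integrable)
  qed
  show "((\<lambda>t. L2_inner (f t) h) has_integral L2_inner I h) {a..b}" if "L2 h"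
  proof -
    from has_bochner_inner[OF M assms that] obtain r
      where r: "integrable (restrict_space lborel {a..b}) r"
        "AE t in restrict_space lborel {a..b}. r t = L2_inner (f t) h"
        "(LINT t|restrict_space lborel {a..b}. r t) = L2_inner I h" by blast
    show ?thesis using has_integral_restrict_lborel[OF r(1,2)] by (simp only: r(3))
  qed
qed

section \<open>Functions with a quadratic modulus of continuity\<close>

lemma quadratic_modulus_imp_const:
  fixes \<phi> m :: "real \<Rightarrow> real"
  assumes "a \<le> b" and cont: "continuous_on {a..b} m" and m: "m a \<le> m b"
    and quad: "\<And>s t. s \<in> {a..b} \<Longrightarrow> t \<in> {a..b} \<Longrightarrow> \<bar>\<phi> t - \<phi> s\<bar> \<le> (m t - m s)\<^sup>2"
  shows "\<phi> b = \<phi> a"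
proof -
  define d where "d = m b - m a"
  have est: "\<bar>\<phi> b - \<phi> a\<bar> \<le> d\<^sup>2 / real n" if n: "0 < n" for n :: nat
  proof -
    have "\<exists>x\<in>{a..b}. m x = m a + d * (real i / real n)" if "i \<le> n" for i
    proof -
      have i: "real i / real n \<le> 1" using that n by simp
      have "0 \<le> d" using m by (simp add: d_def)
      then have "d * (real i / real n) \<le> d * 1" using i by (intro mult_left_mono)
      moreover have "0 \<le> d * (real i / real n)" using \<open>0 \<le> d\<close> by simp
      ultimately show ?thesis
        using IVT'[of m a "m a + d * (real i / real n)" b] cont \<open>a \<le> b\<close> by (auto simp: d_def)
    qed
    then obtain x where x: "\<And>i. i \<le> n \<Longrightarrow> x i \<in> {a..b}"
      "\<And>i. i \<le> n \<Longrightarrow> m (x i) = m a + d * (real i / real n)"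
      by metis
    have "m (x 0) = m a" "m (x n) = m b" using x(2)[of 0] x(2)[of n] n by (simp_all add: d_def)
    then have ends: "\<phi> (x 0) = \<phi> a" "\<phi> (x n) = \<phi> b"
      using quad[of a "x 0"] quad[of b "x n"] x(1)[of 0] x(1)[of n] \<open>a \<le> b\<close> by simp_all
    have "\<bar>\<phi> (x (Suc i)) - \<phi> (x i)\<bar> \<le> (d / real n)\<^sup>2" if "i < n" for i
    proof -
      have "m (x (Suc i)) - m (x i) = d / real n"
        using x(2)[of i] x(2)[of "Suc i"] that n by (simp add: field_simps)
      then show ?thesis using quad[of "x i" "x (Suc i)"] x(1)[of i] x(1)[of "Suc i"] that by simp
    qed
    then have "(\<Sum>i<n. \<bar>\<phi> (x (Suc i)) - \<phi> (x i)\<bar>) \<le> (\<Sum>i<n. (d / real n)\<^sup>2)"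
      by (intro sum_mono) simp
    moreover have "\<phi> b - \<phi> a = (\<Sum>i<n. \<phi> (x (Suc i)) - \<phi> (x i))"
      by (simp add: sum_lessThan_telescope[of "\<lambda>i. \<phi> (x i)"] ends)
    ultimately have "\<bar>\<phi> b - \<phi> a\<bar> \<le> (\<Sum>i<n. (d / real n)\<^sup>2)"
      using sum_abs[of "\<lambda>i. \<phi> (x (Suc i)) - \<phi> (x i)" "{..<n}"] by linarith
    also have "\<dots> = d\<^sup>2 / real n" using n by (simp add: power2_eq_square)
    finally show ?thesis .
  qed
  have "(\<lambda>n. d\<^sup>2 / real n) \<longlonglongrightarrow> 0" by (rule lim_const_over_n)
  then have "\<bar>\<phi> b - \<phi> a\<bar> \<le> 0"
    by (rule LIMSEQ_le_const) (use est in \<open>auto intro!: exI[of _ 1]\<close>)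
  then show ?thesis by simp
qed

section \<open>Curves orthogonal to their derivative\<close>

lemma has_integral_tail:
  fixes f :: "real \<Rightarrow> real"
  assumes "a \<le> s" "s \<le> t" and i: "(f has_integral i) {a..s}" and j: "(f has_integral j) {a..t}"
  shows "(f has_integral (j - i)) {s..t}"
proof -
  obtain l where l: "(f has_integral l) {s..t}"
    using integrable_subinterval_real[OF has_integral_integrable[OF j], of s t] assms(1) by auto
  have "i + l = j" using has_integral_combine[OF assms(1,2) i l] j by (rule has_integral_unique)
  then show ?thesis using l by auto
qed

lemma has_integral_init:
  fixes f :: "real \<Rightarrow> real"
  assumes "s \<le> t" "t \<le> b" and i: "(f has_integral i) {s..b}" and j: "(f has_integral j) {t..b}"
  shows "(f has_integral (i - j)) {s..t}"
proof -
  obtain l where l: "(f has_integral l) {s..t}"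
    using integrable_subinterval_real[OF has_integral_integrable[OF i], of s t] assms(2) by auto
  have "l + j = i" using has_integral_combine[OF assms(1,2) l j] i by (rule has_integral_unique)
  then show ?thesis using l by auto
qed

text \<open>The hypothesis \<open>deriv\<close> states that \<open>k\<close> is the derivative of \<open>w\<close> in the weak integrated sense.\<close>

lemma weak_derivative_orthogonal_imp_const_nrm:
  fixes a b :: real and w k :: "real \<Rightarrow> plane \<Rightarrow> complex"
  assumes "a \<le> b" and w: "\<And>t. t \<in> {a..b} \<Longrightarrow> L2 (w t)" and k: "\<And>t. t \<in> {a..b} \<Longrightarrow> L2 (k t)"
    and int: "(\<lambda>t. L2_nrm (k t)) integrable_on {a..b}"
    and deriv: "\<And>h s t. L2 h \<Longrightarrow> a \<le> s \<Longrightarrow> s \<le> t \<Longrightarrow> t \<le> b \<Longrightarrow>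
      ((\<lambda>\<tau>. L2_inner (k \<tau>) h) has_integral (L2_inner (w t) h - L2_inner (w s) h)) {s..t}"
    and orth: "\<And>t. t \<in> {a..b} \<Longrightarrow> L2_inner (k t) (w t) = 0"
  shows "L2_nrm (w b) = L2_nrm (w a)"
proof -
  define m where "m t = integral {a..t} (\<lambda>\<tau>. L2_nrm (k \<tau>))" for t
  have int_k: "((\<lambda>\<tau>. L2_nrm (k \<tau>)) has_integral (m t - m s)) {s..t}" if "a \<le> s" "s \<le> t" "t \<le> b" for s t
    unfolding m_def using that
    by (intro has_integral_tail[of a] integrable_integral integrable_subinterval_real[OF int]) auto
  have m_mono: "m s \<le> m t" if "a \<le> s" "s \<le> t" "t \<le> b" for s t
    using has_integral_nonneg[OF int_k[OF that]] by simp
  have pairing: "L2_inner (w t) h - L2_inner (w s) h \<le> (m t - m s) * B"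
    if st: "a \<le> s" "s \<le> t" "t \<le> b" and h: "L2 h"
      and B: "\<And>\<tau>. \<tau> \<in> {s..t} \<Longrightarrow> L2_inner (k \<tau>) h \<le> L2_nrm (k \<tau>) * B" for s t h B
    by (rule has_integral_le[OF deriv[OF h st] has_integral_mult_left[OF int_k[OF st]]]) (rule B)
  \<comment> \<open>The increment of \<open>w\<close> is tested against itself.\<close>
  have lip: "L2_nrm (\<lambda>x. w t x - w s x) \<le> m t - m s" if st: "a \<le> s" "s \<le> t" "t \<le> b" for s t
  proof -
    let ?h = "\<lambda>x. w t x - w s x"
    have ws: "L2 (w s)" "L2 (w t)" and h: "L2 ?h" using st by (auto intro!: w L2_diff)
    have "(L2_nrm ?h)\<^sup>2 = L2_inner (w t) ?h - L2_inner (w s) ?h"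
      using L2_inner_diff_left[OF ws(2,1) h] by (simp add: L2_nrm_sq[OF h])
    also have "\<dots> \<le> (m t - m s) * L2_nrm ?h"
    proof (rule pairing[OF st h])
      fix \<tau> assume "\<tau> \<in> {s..t}"
      then have "L2 (k \<tau>)" using st by (intro k) auto
      then show "L2_inner (k \<tau>) ?h \<le> L2_nrm (k \<tau>) * L2_nrm ?h"
        using L2_Cauchy_Schwarz[OF _ h, of "k \<tau>"] by simp
    qed
    finally have le: "L2_nrm ?h * L2_nrm ?h \<le> (m t - m s) * L2_nrm ?h"
      by (simp add: power2_eq_square)
    show ?thesis
    proof (cases "L2_nrm ?h = 0")
      case True then show ?thesis using m_mono[OF st] by simp
    next
      case False
      then have "0 < L2_nrm ?h" using L2_nrm_nonneg[of ?h] by linarith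
      then show ?thesis using le by (simp only: mult_le_cancel_right_pos)
    qed
  qed
  have quad: "\<bar>(L2_nrm (w t))\<^sup>2 - (L2_nrm (w s))\<^sup>2\<bar> \<le> (m t - m s)\<^sup>2"
    if st: "a \<le> s" "s \<le> t" "t \<le> b" for s t
  proof -
    let ?h = "\<lambda>x. w t x + w s x" and ?h' = "\<lambda>x. of_real (-1) * (w t x + w s x)"
    have ws: "L2 (w s)" "L2 (w t)" and h: "L2 ?h"
      using st by (auto intro!: w L2_add)
    have h': "L2 ?h'" by (rule L2_cmult[OF h])
    have B: "\<bar>L2_inner (k \<tau>) ?h\<bar> \<le> L2_nrm (k \<tau>) * (m t - m s)" if \<tau>: "\<tau> \<in> {s..t}" for \<tau>
    proof -
      have k\<tau>: "L2 (k \<tau>)" and w\<tau>: "L2 (w \<tau>)" using \<tau> st by (auto intro!: k w)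
      let ?d = "\<lambda>x. w t x - w \<tau> x" and ?e = "\<lambda>x. w \<tau> x - w s x"
      have d: "L2 ?d" and e: "L2 ?e" using ws w\<tau> by (auto intro!: L2_diff)
      \<comment> \<open>By orthogonality, \<open>2 w(\<tau>)\<close> may be subtracted from \<open>w(t) + w(s)\<close>.\<close>
      have "L2_inner (k \<tau>) ?h = L2_inner (k \<tau>) ?d - L2_inner (k \<tau>) ?e"
        using ws w\<tau> k\<tau> orth[of \<tau>] \<tau> st by (simp add: L2_inner_diff_right L2_inner_add_right)
      moreover have "\<bar>L2_inner (k \<tau>) ?d\<bar> \<le> L2_nrm (k \<tau>) * (m t - m \<tau>)"
        using L2_Cauchy_Schwarz[OF k\<tau> d] lip[of \<tau> t] \<tau> st
          mult_left_mono[of "L2_nrm ?d" "m t - m \<tau>" "L2_nrm (k \<tau>)"] by simp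
      moreover have "\<bar>L2_inner (k \<tau>) ?e\<bar> \<le> L2_nrm (k \<tau>) * (m \<tau> - m s)"
        using L2_Cauchy_Schwarz[OF k\<tau> e] lip[of s \<tau>] \<tau> st
          mult_left_mono[of "L2_nrm ?e" "m \<tau> - m s" "L2_nrm (k \<tau>)"] by simp
      ultimately have "\<bar>L2_inner (k \<tau>) ?h\<bar> \<le> L2_nrm (k \<tau>) * (m t - m \<tau>) + L2_nrm (k \<tau>) * (m \<tau> - m s)"
        by linarith
      then show ?thesis by (simp add: algebra_simps)
    qed
    have "L2_inner (w t) ?h - L2_inner (w s) ?h \<le> (m t - m s) * (m t - m s)"
      by (rule pairing[OF st h]) (use B in fastforce)
    moreover have "L2_inner (w t) ?h' - L2_inner (w s) ?h' \<le> (m t - m s) * (m t - m s)"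
      by (rule pairing[OF st h'], subst L2_inner_scale_right) (use B in fastforce)
    moreover have "L2_inner (w t) ?h - L2_inner (w s) ?h = (L2_nrm (w t))\<^sup>2 - (L2_nrm (w s))\<^sup>2"
      using ws by (simp add: L2_inner_add_right L2_nrm_sq L2_inner_commute[of "w t" "w s"])
    ultimately show ?thesis
      by (simp only: L2_inner_scale_right) (simp add: power2_eq_square)
  qed
  have "(L2_nrm (w b))\<^sup>2 = (L2_nrm (w a))\<^sup>2"
  proof (rule quadratic_modulus_imp_const[OF \<open>a \<le> b\<close>])
    show "continuous_on {a..b} m"
      unfolding m_def by (rule indefinite_integral_continuous_1[OF int])
    show "m a \<le> m b" using \<open>a \<le> b\<close> by (intro m_mono) auto
    show "\<bar>(L2_nrm (w t))\<^sup>2 - (L2_nrm (w s))\<^sup>2\<bar> \<le> (m t - m s)\<^sup>2"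
      if "s \<in> {a..b}" "t \<in> {a..b}" for s t
      using quad[of s t] quad[of t s] that
      by (cases "s \<le> t") (auto simp: abs_minus_commute power2_commute)
  qed
  then show ?thesis by simp
qed

section \<open>Unitary groups\<close>

lemma unitary_group_L2: "unitary_group U \<Longrightarrow> L2 f \<Longrightarrow> L2 (U t f)"
  by (simp add: unitary_group_def)

lemma unitary_group_nrm: "unitary_group U \<Longrightarrow> L2 f \<Longrightarrow> L2_nrm (U t f) = L2_nrm f"
  by (simp add: unitary_group_def L2_nrm_def)

lemma unitary_group_cmult:
  assumes U: "unitary_group U" and f: "L2 f"
  shows "AE x in lborel. U t (\<lambda>y. c * f y) x = c * U t f x"
proof -
  \<comment> \<open>Homogeneity is the case \<open>g = f\<close> of linearity in the form \<open>f + (c - 1) g\<close>.\<close>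
  have "AE x in lborel. U t (\<lambda>y. f y + (c - 1) * f y) x = U t f x + (c - 1) * U t f x"
    using U f unfolding unitary_group_def by blast
  then show ?thesis by (simp add: algebra_simps)
qed

text \<open>By polarization of the norm.\<close>

lemma unitary_group_inner:
  assumes U: "unitary_group U" and f: "L2 f" and g: "L2 g"
  shows "L2_inner (U t f) (U t g) = L2_inner f g"
proof -
  note L2 = unitary_group_L2[OF U] and nrm = unitary_group_nrm[OF U]
  have "AE x in lborel. U t (\<lambda>y. f y + 1 * g y) x = U t f x + 1 * U t g x"
    using U f g unfolding unitary_group_def by blast
  then have ae: "AE x in lborel. U t f x + U t g x = U t (\<lambda>y. f y + g y) x" by auto
  have "(L2_nrm (\<lambda>x. U t f x + U t g x))\<^sup>2 = (L2_nrm (U t (\<lambda>y. f y + g y)))\<^sup>2"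
    using L2_inner_cong_AE[OF _ _ _ _ ae ae] L2_add[OF L2[OF f] L2[OF g]] L2[OF L2_add[OF f g]]
    by (simp add: L2_nrm_sq)
  then show ?thesis
    using L2_nrm_add_sq[OF L2[OF f] L2[OF g]] L2_nrm_add_sq[OF f g]
    by (simp add: nrm[OF f] nrm[OF g] nrm[OF L2_add[OF f g]])
qed

lemma unitary_group_cancel:
  assumes U: "unitary_group U" and f: "L2 f"
  shows "AE x in lborel. U t (U (- t) f) x = f x"
proof -
  have "AE x in lborel. U (t + - t) f x = U t (U (- t) f) x" "AE x in lborel. U 0 f x = f x"
    using U f unfolding unitary_group_def by blast+
  then show ?thesis by eventually_elim simp
qed

lemma unitary_group_adjoint:
  assumes U: "unitary_group U" and f: "L2 f" and g: "L2 g"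
  shows "L2_inner (U (- t) f) g = L2_inner f (U t g)"
proof -
  note L2 = unitary_group_L2[OF U]
  have "L2_inner (U (- t) f) g = L2_inner (U t (U (- t) f)) (U t g)"
    using unitary_group_inner[OF U L2[OF f] g] by simp
  also have "\<dots> = L2_inner f (U t g)"
    by (rule L2_inner_cong_AE[OF _ _ _ _ unitary_group_cancel[OF U f] AE_I2])
      (auto intro!: L2 f g)
  finally show ?thesis .
qed

lemma unitary_group_inner_shift:
  assumes U: "unitary_group U" and f: "L2 f" and g: "L2 g"
  shows "L2_inner (U (t - s) f) (U t g) = L2_inner f (U s g)"
proof -
  note L2 = unitary_group_L2[OF U]
  have "AE x in lborel. U ((t - s) + s) g x = U (t - s) (U s g) x"
    using U g unfolding unitary_group_def by blast
  then have "AE x in lborel. U t g x = U (t - s) (U s g) x" by simp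
  then have "L2_inner (U (t - s) f) (U t g) = L2_inner (U (t - s) f) (U (t - s) (U s g))"
    by (intro L2_inner_cong_AE L2 f g) auto
  then show ?thesis by (simp add: unitary_group_inner[OF U f L2[OF g]])
qed

lemma unitary_group_inner_cmult_left:
  assumes U: "unitary_group U" and f: "L2 f" and g: "L2 g"
  shows "L2_inner (\<lambda>x. c * f x) (U t g) = L2_inner f (U t (\<lambda>x. cnj c * g x))"
proof -
  note L2 = unitary_group_L2[OF U]
  have "L2_inner f (\<lambda>x. cnj c * U t g x) = L2_inner f (U t (\<lambda>x. cnj c * g x))"
    using unitary_group_cmult[OF U g, of t "cnj c"]
    by (intro L2_inner_cong_AE L2 L2_cmult f g) auto
  then show ?thesis by (simp add: L2_inner_cmult_left)
qed

lemma L2_nrm_cmult: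
  assumes "L2 f" shows "L2_nrm (\<lambda>x. c * f x) = cmod c * L2_nrm f"
proof -
  have "L2_inner (\<lambda>x. c * f x) (\<lambda>x. c * f x) = (cmod c)\<^sup>2 * L2_inner f f"
    by (simp add: L2_inner_self norm_mult power_mult_distrib)
  then show ?thesis
    using assms by (simp add: L2_nrm_eq L2_cmult real_sqrt_mult)
qed

text \<open>Testing Duhamel's integral against \<open>U t h\<close> removes the dependence of the integrand on \<open>t\<close>.
  The function \<open>G\<close> is \<open>N\<close>, replaced by zero at the times where \<open>N\<close> is not in \<open>L\<^sup>2\<close>,
  because nothing is known of \<open>U\<close> outside \<open>L\<^sup>2\<close>.\<close>

lemma duhamel_weak:
  fixes N :: "real \<Rightarrow> plane \<Rightarrow> complex" and c :: complex
  defines "G \<equiv> \<lambda>\<tau> x. if L2 (N \<tau>) then N \<tau> x else 0"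
  assumes U: "unitary_group U"
    and J: "has_bochner (Lp_norm 2) (restrict_space lborel {a..b}) (\<lambda>\<tau>. U (t - \<tau>) (N \<tau>)) J"
    and N: "AE \<tau> in lborel. \<tau> \<in> {a..b} \<longrightarrow> L2 (N \<tau>)"
  shows "(\<lambda>\<tau>. L2_nrm (U (- \<tau>) (\<lambda>x. c * G \<tau> x))) integrable_on {a..b}"
    and "L2 h \<Longrightarrow> ((\<lambda>\<tau>. L2_inner (U (- \<tau>) (\<lambda>x. c * G \<tau> x)) h) has_integral
      L2_inner (\<lambda>x. c * J x) (U t h)) {a..b}"
proof -
  note L2 = unitary_group_L2[OF U]
  obtain i where "((\<lambda>\<tau>. L2_nrm (U (t - \<tau>) (N \<tau>))) has_integral i) {a..b}"
    using has_bochner_interval(2)[OF J] by auto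
  then have i: "((\<lambda>\<tau>. cmod c * L2_nrm (U (t - \<tau>) (N \<tau>))) has_integral (cmod c * i)) {a..b}"
    by (rule has_integral_mult_right)
  have "AE \<tau> in lborel. \<tau> \<in> {a..b} \<longrightarrow>
      cmod c * L2_nrm (U (t - \<tau>) (N \<tau>)) = L2_nrm (U (- \<tau>) (\<lambda>x. c * G \<tau> x))"
    using N by eventually_elim
      (auto simp: G_def unitary_group_nrm[OF U] L2_nrm_cmult L2_cmult)
  from has_integral_AE[THEN iffD1, OF this i]
  show "(\<lambda>\<tau>. L2_nrm (U (- \<tau>) (\<lambda>x. c * G \<tau> x))) integrable_on {a..b}"
    by (rule has_integral_integrable)
  assume h: "L2 h"
  let ?h = "U t (\<lambda>x. cnj c * h x)"
  have "L2 J" using J by (simp add: has_bochner_def)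
  then have eq: "L2_inner J ?h = L2_inner (\<lambda>x. c * J x) (U t h)"
    using unitary_group_inner_cmult_left[OF U _ h] by simp
  have J_h: "((\<lambda>\<tau>. L2_inner (U (t - \<tau>) (N \<tau>)) ?h) has_integral L2_inner J ?h) {a..b}"
    by (rule has_bochner_interval(3)[OF J]) (intro L2 L2_cmult h)
  have "AE \<tau> in lborel. \<tau> \<in> {a..b} \<longrightarrow>
      L2_inner (U (t - \<tau>) (N \<tau>)) ?h = L2_inner (U (- \<tau>) (\<lambda>x. c * G \<tau> x)) h"
    using N
  proof eventually_elim
    case (elim \<tau>)
    show ?case
    proof
      assume "\<tau> \<in> {a..b}"
      then have N\<tau>: "L2 (N \<tau>)" using elim by simp
      have "L2_inner (U (t - \<tau>) (N \<tau>)) ?h = L2_inner (N \<tau>) (U \<tau> (\<lambda>x. cnj c * h x))"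
        by (rule unitary_group_inner_shift[OF U N\<tau> L2_cmult[OF h]])
      also have "\<dots> = L2_inner (\<lambda>x. c * N \<tau> x) (U \<tau> h)"
        by (rule unitary_group_inner_cmult_left[OF U N\<tau> h, symmetric])
      also have "\<dots> = L2_inner (U (- \<tau>) (\<lambda>x. c * N \<tau> x)) h"
        by (rule unitary_group_adjoint[OF U L2_cmult[OF N\<tau>] h, symmetric])
      finally show "L2_inner (U (t - \<tau>) (N \<tau>)) ?h = L2_inner (U (- \<tau>) (\<lambda>x. c * G \<tau> x)) h"
        using N\<tau> by (simp add: G_def)
    qed
  qed
  from has_integral_AE[THEN iffD1, OF this J_h]
  show "((\<lambda>\<tau>. L2_inner (U (- \<tau>) (\<lambda>x. c * G \<tau> x)) h) has_integral
      L2_inner (\<lambda>x. c * J x) (U t h)) {a..b}"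
    unfolding eq .
qed

section \<open>The nonlinearity\<close>

lemma Lp_norm_add_finite:
  assumes r: "0 < r" and f: "Lp_norm (ennreal r) f < \<infinity>" and g: "Lp_norm (ennreal r) g < \<infinity>"
  shows "Lp_norm (ennreal r) (\<lambda>x. f x + g x) < \<infinity>"
proof -
  have m: "f \<in> borel_measurable lborel" "g \<in> borel_measurable lborel"
    and i: "integrable lborel (\<lambda>x. cmod (f x) powr r)" "integrable lborel (\<lambda>x. cmod (g x) powr r)"
    using f g by (auto simp: Lp_norm_finite_iff[OF r])
  have "integrable lborel (\<lambda>x. cmod (f x + g x) powr r)"
  proof (rule Bochner_Integration.integrable_bound)
    show "integrable lborel (\<lambda>x. 2 powr r * (cmod (f x) powr r + cmod (g x) powr r))"
      using i by auto
    have "cmod (f x + g x) powr r \<le> 2 powr r * (cmod (f x) powr r + cmod (g x) powr r)" for x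
    proof -
      have "cmod (f x + g x) \<le> 2 * max (cmod (f x)) (cmod (g x))"
        using norm_triangle_ineq[of "f x" "g x"] by linarith
      then have "cmod (f x + g x) powr r \<le> (2 * max (cmod (f x)) (cmod (g x))) powr r"
        using r by (intro powr_mono2) auto
      also have "\<dots> = 2 powr r * max (cmod (f x)) (cmod (g x)) powr r"
        by (rule powr_mult)
      also have "\<dots> \<le> 2 powr r * (cmod (f x) powr r + cmod (g x) powr r)"
        by (intro mult_left_mono) (auto simp: max_def)
      finally show ?thesis .
    qed
    then show "AE x in lborel. norm (cmod (f x + g x) powr r) \<le>
        norm (2 powr r * (cmod (f x) powr r + cmod (g x) powr r))"
      by (intro AE_I2) (simp add: abs_mult)
    show "(\<lambda>x. cmod (f x + g x) powr r) \<in> borel_measurable lborel" using m by simp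
  qed
  then show ?thesis using m by (simp add: Lp_norm_finite_iff[OF r])
qed

text \<open>Almost every value is the sum of a value of a simple approximant and a remainder of finite
  norm.\<close>

lemma strongly_measurable_Lp_AE_finite:
  assumes r: "0 < r" and u: "strongly_measurable (Lp_norm (ennreal r)) M u"
  shows "AE t in M. Lp_norm (ennreal r) (u t) < \<infinity>"
proof -
  obtain s where s: "\<And>n::nat. simple_in (Lp_norm (ennreal r)) M (s n)"
    and lim: "AE t in M. (\<lambda>n. Lp_norm (ennreal r) (\<lambda>x. u t x - s n t x)) \<longlonglongrightarrow> 0"
    using u by (auto simp: strongly_measurable_def)
  show ?thesis
    using lim AE_space
  proof eventually_elim
    case (elim t)
    from order_tendstoD(2)[OF elim(1), of \<infinity>]
    obtain n where "Lp_norm (ennreal r) (\<lambda>x. u t x - s n t x) < \<infinity>"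
      by (auto simp: eventually_sequentially infinity_ennreal_def)
    moreover have "Lp_norm (ennreal r) (s n t) < \<infinity>"
      using s[of n] elim(2) by (simp add: simple_in_def)
    ultimately show ?case using Lp_norm_add_finite[OF r] by fastforce
  qed
qed

lemma L2_nonlin:
  assumes "0 < \<gamma>" and f: "Lp_norm (ennreal (4 * \<gamma> + 2)) f < \<infinity>"
  shows "L2 (nonlin \<gamma> f)"
proof -
  have r: "0 < 4 * \<gamma> + 2" using assms(1) by simp
  have m[measurable]: "f \<in> borel_measurable lborel" and i: "integrable lborel (\<lambda>x. cmod (f x) powr (4 * \<gamma> + 2))"
    using f by (auto simp: Lp_norm_finite_iff[OF r])
  have "(cmod (nonlin \<gamma> f x))\<^sup>2 = cmod (f x) powr (4 * \<gamma> + 2)" for x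
  proof (cases "f x = 0")
    case False
    have "(cmod (nonlin \<gamma> f x))\<^sup>2 = (cmod (f x) powr (2 * \<gamma>))\<^sup>2 * (cmod (f x))\<^sup>2"
      by (simp add: nonlin_def norm_mult power_mult_distrib)
    also have "\<dots> = cmod (f x) powr (4 * \<gamma>) * cmod (f x) powr 2"
      using False by (simp add: powr_numeral power2_eq_square powr_add[symmetric])
    finally show ?thesis by (simp add: powr_add)
  qed (simp add: nonlin_def)
  moreover have "nonlin \<gamma> f \<in> borel_measurable lborel"
    unfolding nonlin_def[abs_def] by measurable
  ultimately show ?thesis using i by (simp add: L2_iff)
qed

text \<open>The pointwise product is purely imaginary, so no integrability of \<open>f\<close> is needed.\<close>

lemma nonlin_gauge_orthogonal:
  "L2_inner (\<lambda>x. \<i> * of_real lam * nonlin \<gamma> f x) f = 0"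
proof -
  have "(\<i> * of_real lam * nonlin \<gamma> f x) * cnj (f x)
      = \<i> * of_real (lam * (cmod (f x) powr (2 * \<gamma>) * (cmod (f x))\<^sup>2))" for x
    by (simp add: nonlin_def complex_norm_square[symmetric] mult.assoc del: of_real_power)
  then have "(LINT x|lborel. (\<i> * of_real lam * nonlin \<gamma> f x) * cnj (f x))
      = \<i> * (LINT x|lborel. of_real (lam * (cmod (f x) powr (2 * \<gamma>) * (cmod (f x))\<^sup>2)))"
    by (simp only: integral_mult_right_zero)
  also have "\<dots> = \<i> * of_real (LINT x|lborel. lam * (cmod (f x) powr (2 * \<gamma>) * (cmod (f x))\<^sup>2))"
    by (simp only: integral_complex_of_real)
  finally show ?thesis by (simp add: L2_inner_def)
qed

section \<open>Conservation of mass\<close>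

text \<open>Mass is conserved for every unitary group, whatever its generator. At almost every
  time, \<open>u\<close> lies in \<open>L\<^sup>4\<^sup>\<gamma>\<^sup>+\<^sup>2\<close>, hence its nonlinearity in \<open>L\<^sup>2\<close>, where \<open>U\<close> is unitary.\<close>

lemma mild_solution_mass:
  assumes U: "unitary_group U" and "0 < \<gamma>"
    and Lr: "Lr_loc T r (ennreal (4 * \<gamma> + 2)) u"
    and mild: "mild_solution U lam \<gamma> T u"
    and t: "t \<in> {-T<..<T}"
  shows "Lp_norm 2 (u t) = Lp_norm 2 (u 0)"
proof -
  note L2 = unitary_group_L2[OF U]
  define N where "N \<tau> = nonlin \<gamma> (u \<tau>)" for \<tau>
  define G where "G \<tau> x = (if L2 (N \<tau>) then N \<tau> x else 0)" for \<tau> x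
  define c where "c = \<i> * complex_of_real lam"
  define w where "w \<tau> = U (- \<tau>) (u \<tau>)" for \<tau>
  define k where "k \<tau> = U (- \<tau>) (\<lambda>x. c * G \<tau> x)" for \<tau>
  have u: "L2 (u s)" if "s \<in> {-T<..<T}" for s
    using mild that by (auto simp: mild_solution_def)
  have T0: "0 \<in> {-T<..<T}" using t by auto
  have G: "L2 (G \<tau>)" for \<tau>
    by (cases "L2 (N \<tau>)") (simp_all add: G_def[abs_def] L2_zero)
  have w: "L2 (w s)" if "s \<in> {-T<..<T}" for s
    unfolding w_def by (intro L2 u that)
  have k: "L2 (k s)" for s
    unfolding k_def by (intro L2 L2_cmult G)
  have "AE \<tau> in restrict_space lborel {-T<..<T}. Lp_norm (ennreal (4 * \<gamma> + 2)) (u \<tau>) < \<infinity>"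
    using Lr \<open>0 < \<gamma>\<close> by (intro strongly_measurable_Lp_AE_finite) (auto simp: Lr_loc_def)
  then have N: "AE \<tau> in lborel. \<tau> \<in> {-T<..<T} \<longrightarrow> L2 (N \<tau>)"
    by (auto simp: AE_restrict_space_iff N_def elim!: eventually_mono intro!: L2_nonlin[OF \<open>0 < \<gamma>\<close>])
  have w_inner: "L2_inner (w s) h = L2_inner (u s) (U s h)" if "s \<in> {-T<..<T}" "L2 h" for s h
    unfolding w_def by (rule unitary_group_adjoint[OF U u[OF that(1)] that(2)])
  have orth: "L2_inner (k s) (w s) = 0" if s: "s \<in> {-T<..<T}" for s
  proof -
    have "L2_inner (k s) (w s) = L2_inner (\<lambda>x. c * G s x) (U s (w s))"
      unfolding k_def by (rule unitary_group_adjoint[OF U L2_cmult[OF G] w[OF s]])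
    also have "\<dots> = L2_inner (\<lambda>x. c * G s x) (u s)"
      unfolding w_def
      by (rule L2_inner_cong_AE[OF _ _ _ _ AE_I2 unitary_group_cancel[OF U u[OF s]]])
        (auto intro!: L2_cmult G L2 u s)
    also have "\<dots> = 0"
    proof (cases "L2 (N s)")
      case True
      then show ?thesis using nonlin_gauge_orthogonal by (simp add: G_def c_def N_def)
    qed (simp add: G_def L2_inner_def)
    finally show ?thesis .
  qed
  \<comment> \<open>Duhamel's formula tested against \<open>U s h\<close>; the time \<open>s\<close> may have either sign.\<close>
  have duh: "L2_inner (w s) h - L2_inner (w 0) h = L2_inner (\<lambda>x. c * I x) (U s h)"
    if s: "s \<in> {-T<..<T}" and h: "L2 h" and I: "L2 I"
      and eq: "AE x in lborel. u s x = U s (u 0) x + c * I x" for s h I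
  proof -
    have "L2_inner (w s) h = L2_inner (\<lambda>x. U s (u 0) x + c * I x) (U s h)"
      unfolding w_inner[OF s h]
      by (rule L2_inner_cong_AE[OF _ _ _ _ eq AE_I2]) (auto intro!: L2_add L2_cmult L2 u s T0 I h)
    also have "\<dots> = L2_inner (u 0) h + L2_inner (\<lambda>x. c * I x) (U s h)"
      using unitary_group_inner[OF U u[OF T0] h, of s]
      by (subst L2_inner_add_left) (auto intro!: L2_cmult L2 u T0 I h)
    also have "L2_inner (u 0) h = L2_inner (w 0) h"
    proof -
      have "AE x in lborel. U 0 h x = h x" using U h by (simp add: unitary_group_def)
      then show ?thesis
        unfolding w_inner[OF T0 h]
        by (intro L2_inner_cong_AE) (auto intro!: L2 u T0 h)
    qed
    finally show ?thesis by simp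
  qed
  have "\<forall>s\<in>{-T<..<T}. \<exists>I. has_L2_integral 0 s (\<lambda>\<tau>. U (s - \<tau>) (N \<tau>)) I \<and>
      (AE x in lborel. u s x = U s (u 0) x + c * I x)"
    using mild unfolding mild_solution_def N_def c_def by blast
  from bchoice[OF this] obtain I
    where I: "\<And>s. s \<in> {-T<..<T} \<Longrightarrow> has_L2_integral 0 s (\<lambda>\<tau>. U (s - \<tau>) (N \<tau>)) (I s)"
      "\<And>s. s \<in> {-T<..<T} \<Longrightarrow> AE x in lborel. u s x = U s (u 0) x + c * I s x"
    by blast
  have pos: "(\<lambda>\<tau>. L2_nrm (k \<tau>)) integrable_on {0..s} \<and>
      (L2 h \<longrightarrow> ((\<lambda>\<tau>. L2_inner (k \<tau>) h) has_integral (L2_inner (w s) h - L2_inner (w 0) h)) {0..s})"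
    if s: "s \<in> {-T<..<T}" "0 \<le> s" for s h
  proof -
    have J: "has_bochner (Lp_norm 2) (restrict_space lborel {0..s}) (\<lambda>\<tau>. U (s - \<tau>) (N \<tau>)) (I s)"
      using I(1)[OF s(1)] s(2) by (simp add: has_L2_integral_def)
    have N': "AE \<tau> in lborel. \<tau> \<in> {0..s} \<longrightarrow> L2 (N \<tau>)"
      using N by eventually_elim (use s in auto)
    have "L2 (I s)" using J by (simp add: has_bochner_def)
    then show ?thesis
      using duhamel_weak[OF U J N', where c = c] duh[OF s(1) _ _ I(2)[OF s(1)]]
      by (simp add: k_def G_def)
  qed
  have neg: "(\<lambda>\<tau>. L2_nrm (k \<tau>)) integrable_on {s..0} \<and>
      (L2 h \<longrightarrow> ((\<lambda>\<tau>. L2_inner (k \<tau>) h) has_integral (L2_inner (w 0) h - L2_inner (w s) h)) {s..0})"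
    if s: "s \<in> {-T<..<T}" "s \<le> 0" for s h
  proof (cases "s = 0")
    case True then show ?thesis using pos[OF T0, of h] by simp
  next
    case False
    have J: "has_bochner (Lp_norm 2) (restrict_space lborel {s..0}) (\<lambda>\<tau>. U (s - \<tau>) (N \<tau>)) (\<lambda>x. - I s x)"
      using I(1)[OF s(1)] s(2) False by (simp add: has_L2_integral_def)
    have N': "AE \<tau> in lborel. \<tau> \<in> {s..0} \<longrightarrow> L2 (N \<tau>)"
      using N by eventually_elim (use s in auto)
    have "L2 (\<lambda>x. - I s x)" using J by (simp add: has_bochner_def)
    from L2_cmult[OF this, of "-1"] have I': "L2 (I s)" by simp
    have "L2_inner (\<lambda>x. c * - I s x) (U s h) = L2_inner (w 0) h - L2_inner (w s) h" if "L2 h"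
      using duh[OF s(1) that I' I(2)[OF s(1)]] L2_inner_scale_left[of "-1" "\<lambda>x. c * I s x" "U s h"]
      by simp
    note eq = this
    show ?thesis
    proof (intro conjI impI)
      show "(\<lambda>\<tau>. L2_nrm (k \<tau>)) integrable_on {s..0}"
        using duhamel_weak(1)[OF U J N', where c = c] by (simp add: k_def G_def)
      assume h: "L2 h"
      show "((\<lambda>\<tau>. L2_inner (k \<tau>) h) has_integral (L2_inner (w 0) h - L2_inner (w s) h)) {s..0}"
        using duhamel_weak(2)[OF U J N' h, where c = c] unfolding eq[OF h]
        by (simp add: k_def G_def)
    qed
  qed
  have "L2_nrm (w t) = L2_nrm (w 0)"
  proof (cases "0 \<le> t")
    case True
    have range: "s \<in> {-T<..<T}" if "s \<in> {0..t}" for s using that t by auto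
    show ?thesis
    proof (rule weak_derivative_orthogonal_imp_const_nrm[OF True, of w k])
      show "(\<lambda>\<tau>. L2_nrm (k \<tau>)) integrable_on {0..t}" using pos[OF t True] by blast
      fix h s s' assume h: "L2 h" and s: "0 \<le> s" "s \<le> s'" "s' \<le> t"
      have "s \<in> {-T<..<T}" "s' \<in> {-T<..<T}" "0 \<le> s'" using s t by auto
      then have "((\<lambda>\<tau>. L2_inner (k \<tau>) h) has_integral (L2_inner (w s) h - L2_inner (w 0) h)) {0..s}"
        "((\<lambda>\<tau>. L2_inner (k \<tau>) h) has_integral (L2_inner (w s') h - L2_inner (w 0) h)) {0..s'}"
        using pos h s(1) by blast+
      from has_integral_tail[OF s(1,2) this]
      show "((\<lambda>\<tau>. L2_inner (k \<tau>) h) has_integral (L2_inner (w s') h - L2_inner (w s) h)) {s..s'}"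
        by simp
    qed (use w k orth range in blast)+
  next
    case False
    then have le: "t \<le> 0" by simp
    have range: "s \<in> {-T<..<T}" if "s \<in> {t..0}" for s using that t by auto
    have "L2_nrm (w 0) = L2_nrm (w t)"
    proof (rule weak_derivative_orthogonal_imp_const_nrm[OF le, of w k])
      show "(\<lambda>\<tau>. L2_nrm (k \<tau>)) integrable_on {t..0}" using neg[OF t le] by blast
      fix h s s' assume h: "L2 h" and s: "t \<le> s" "s \<le> s'" "s' \<le> 0"
      have "s \<in> {-T<..<T}" "s' \<in> {-T<..<T}" "s \<le> 0" using s t by auto
      then have "((\<lambda>\<tau>. L2_inner (k \<tau>) h) has_integral (L2_inner (w 0) h - L2_inner (w s) h)) {s..0}"
        "((\<lambda>\<tau>. L2_inner (k \<tau>) h) has_integral (L2_inner (w 0) h - L2_inner (w s') h)) {s'..0}"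
        using neg h s(3) by blast+
      from has_integral_init[OF s(2,3) this]
      show "((\<lambda>\<tau>. L2_inner (k \<tau>) h) has_integral (L2_inner (w s') h - L2_inner (w s) h)) {s..s'}"
        by simp
    qed (use w k orth range in blast)+
    then show ?thesis ..
  qed
  then have "L2_nrm (u t) = L2_nrm (u 0)"
    by (simp add: w_def unitary_group_nrm[OF U] u[OF t] u[OF T0])
  then show ?thesis
    using Lp_norm_L2_nrm[OF u[OF t]] Lp_norm_L2_nrm[OF u[OF T0]] by simp
qed

theorem lemma4p11:
  fixes \<kappa> \<delta> lam T \<gamma> :: real
    and \<xi> Z :: distr
    and Y :: "plane \<Rightarrow> real"
    and U :: "real \<Rightarrow> (plane \<Rightarrow> complex) \<Rightarrow> plane \<Rightarrow> complex"
    and u :: "real \<Rightarrow> plane \<Rightarrow> complex"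
  assumes "0 < \<kappa>" and "\<kappa> < 1 / 2"
    and "dist_real \<xi>" and "W_norm (- 1 - \<kappa>) \<infinity> \<xi> < \<infinity>"
    and "enhanced_noise \<kappa> \<xi> Y Z"
    and "noise_integrability \<kappa> Y Z"
    and "\<delta> > 0" and "coercive \<kappa> Y Z \<delta>"
    and "unitary_group_of (noisy_op \<kappa> Y Z \<delta>) U"
    and "T > 0" and "\<gamma> > 0"
    and "Linf_loc T 2 u"
    and "Lr_loc T (2 * \<gamma> + 1) (ennreal (4 * \<gamma> + 2)) u"
    and "mild_solution U lam \<gamma> T u"
  shows "\<forall>t\<in>{-T<..<T}. Lp_norm 2 (u t) = Lp_norm 2 (u 0)"
proof
  fix t assume t: "t \<in> {-T<..<T}"
  have "unitary_group U" using assms(9) by (simp add: unitary_group_of_def)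
  then show "Lp_norm 2 (u t) = Lp_norm 2 (u 0)"
    using \<open>\<gamma> > 0\<close> assms(13,14) t by (rule mild_solution_mass)
qed

end
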